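(* Under the same conditions as in the asymptotic normality result for $(\hat A,\hat C,\hat B)$ (model correctly specified, $\boldsymbol\Sigma$ known, $Z^\top Z/n\to q>0$), let $\hat C'=Z^\top R/(Z^\top Z)$ and $$\hat C=\frac{M^\top M\,Z^\top R-Z^\top M\,M^\top R}{Z^\top Z\,M^\top M-(Z^\top M)^2}+\frac{\delta\sigma_2\,Z^\top M}{\sigma_1\,Z^\top Z}.$$ Then $$\sqrt n\left(\begin{pmatrix}\hat C'\\ \hat C\end{pmatrix}-\begin{pmatrix}C+AB\\ C\end{pmatrix}\right)\xrightarrow{\mathcal D}\mathcal N(\mathbf 0,\boldsymbol V'),$$ where $$\boldsymbol V'=\begin{pmatrix}(B^2\sigma_1^2+2B\delta\sigma_1\sigma_2+\sigma_2^2)/q & (\sigma_2^2+B\delta\sigma_1\sigma_2)/q\\ (\sigma_2^2+B\delta\sigma_1\sigma_2)/q & \sigma_2^2(qA^2+\sigma_1^2-qA^2\delta^2)/(q\sigma_1^2)\end{pmatrix}.$$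
   Context: Single-level mediation model: $Z\in\mathbb{R}^n$ is a (fixed, observed) treatment-assignment vector; $M\in\mathbb{R}^n$ (mediator) and $R\in\mathbb{R}^n$ (outcome) are observed vectors satisfying $$M=ZA+E_1,\qquad R=ZC+MB+E_2,$$ with unknown scalar coefficients $A,B,C$. The errors satisfy $\operatorname{vec}(E_1\ E_2)\sim\mathcal{N}(\mathbf 0,\boldsymbol{\Sigma}\otimes I_n)$ with $\boldsymbol{\Sigma}=\begin{pmatrix}\sigma_1^2&\delta\sigma_1\sigma_2\\ \delta\sigma_1\sigma_2&\sigma_2^2\end{pmatrix}$, $\sigma_1,\sigma_2>0$, $\delta\in(-1,1)$; i.e. the $n$ pairs $(E_{1,j},E_{2,j})$ are i.i.d. bivariate normal with mean zero and covariance $\boldsymbol{\Sigma}$, independent of $Z$. The total effect is $C'=C+AB$. *)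

theory Defs
  imports "HOL-Probability.Probability"
begin

definition normal_law :: "real \<Rightarrow> real measure" where
  "normal_law v = (if v = 0 then return borel 0
                   else density lborel (normal_density 0 (sqrt v)))"

text \<open>Bivariate centered Gaussian law with covariance matrix [[v11, v12], [v12, v22]]:
  a probability measure on R^2 all of whose linear functionals a x + b y are centered normal
  with variance a^2 v11 + 2 a b v12 + b^2 v22 (standard definition of a Gaussian vector).\<close>
definition gaussian2 :: "(real \<times> real) measure \<Rightarrow> real \<Rightarrow> real \<Rightarrow> real \<Rightarrow> bool" where
  "gaussian2 \<mu> v11 v12 v22 \<longleftrightarrow>
     sets \<mu> = sets borel \<and> prob_space \<mu> \<and>
     (\<forall>a b. distr \<mu> borel (\<lambda>(x, y). a * x + b * y)
              = normal_law (a\<^sup>2 * v11 + 2 * a * b * v12 + b\<^sup>2 * v22))"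

definition conv_distr2 ::
  "'a measure \<Rightarrow> (nat \<Rightarrow> 'a \<Rightarrow> real \<times> real) \<Rightarrow> (real \<times> real) measure \<Rightarrow> bool" where
  "conv_distr2 P X \<mu> \<longleftrightarrow>
     (\<forall>f :: real \<times> real \<Rightarrow> real. continuous_on UNIV f \<and> bounded (range f) \<longrightarrow>
        (\<lambda>n. \<integral>\<omega>. f (X n \<omega>) \<partial>P) \<longlonglongrightarrow> (\<integral>x. f x \<partial>\<mu>))"

end

theory Submission
  imports Defs
begin

text \<open>Write the second error as \<open>E\<^sub>2 = \<gamma> E\<^sub>1 + F\<close> with \<open>\<gamma> = \<delta> \<sigma>\<^sub>2 / \<sigma>\<^sub>1\<close> and \<open>F\<close> independent of \<open>E\<^sub>1\<close>.
  Both estimation errors, scaled by \<open>sqrt n\<close>, are linear in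
  \<open>Z\<^sup>T E\<^sub>1 / sqrt n\<close>, \<open>Z\<^sup>T F / sqrt n\<close> and \<open>E\<^sub>1\<^sup>T F / sqrt n\<close>, with coefficients that are continuous functions of
  \<open>Z\<^sup>T Z / n\<close>, \<open>Z\<^sup>T E\<^sub>1 / n\<close> and \<open>E\<^sub>1\<^sup>T E\<^sub>1 / n\<close> and hence converge in probability.
  No Lindeberg condition on \<open>Z\<close> is available, but none is needed: given \<open>E\<^sub>1\<close> the statistics
  \<open>Z\<^sup>T F\<close> and \<open>E\<^sub>1\<^sup>T F\<close> are exactly Gaussian, so their joint characteristic function is
  an expectation over \<open>E\<^sub>1\<close> alone, which converges because the conditional variance does.
  The independence of \<open>E\<^sub>1\<close> and \<open>F\<close> and the convergence in law both come from characteristic functions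
  on Euclidean space, via the continuity theorem there: its one-dimensional case gives tightness,
  and on a large cube trigonometric polynomials are dense.\<close>

section \<open>Borel probability measures\<close>

locale borel_distribution = prob_space M for M :: "'a::topological_space measure" +
  assumes events_eq_borel [simp, measurable_cong]: "sets M = sets borel"
begin

lemma space_eq_UNIV [simp]: "space M = UNIV"
  using sets_eq_imp_space_eq[OF events_eq_borel] by simp

lemma borel_measurable_continuous:
  fixes f :: "'a \<Rightarrow> 'b::topological_space"
  assumes "continuous_on UNIV f"
  shows "f \<in> borel_measurable M"
  using borel_measurable_continuous_onI[OF assms] by measurable

lemma integrable_continuous_bounded:
  fixes f :: "'a \<Rightarrow> 'b::{banach, second_countable_topology}"
  assumes "continuous_on UNIV f" "bounded (range f)"
  shows "integrable M f"
proof -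
  obtain B where "\<And>x. norm (f x) \<le> B"
    using assms(2) by (auto simp: bounded_iff)
  then show ?thesis
    using assms(1) by (intro integrable_const_bound[where B=B] borel_measurable_continuous) auto
qed

end

lemma (in prob_space) borel_distribution_distr:
  "X \<in> borel_measurable M \<Longrightarrow> borel_distribution (distr M borel X)"
  by (simp add: borel_distribution_def borel_distribution_axioms_def prob_space_distr)

lemma (in real_distribution) borel_distribution: "borel_distribution M"
  by (intro borel_distribution.intro borel_distribution_axioms.intro prob_space_axioms events_eq_borel)

lemma borel_distribution_pair:
  fixes M :: "'a::second_countable_topology measure" and N :: "'b::second_countable_topology measure"
  assumes "borel_distribution M" "borel_distribution N"
  shows "borel_distribution (M \<Otimes>\<^sub>M N)"
proof -
  interpret M: borel_distribution M by fact
  interpret N: borel_distribution N by fact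
  interpret MN: pair_prob_space M N ..
  have "sets (M \<Otimes>\<^sub>M N) = sets (borel \<Otimes>\<^sub>M borel)"
    by (intro sets_pair_measure_cong) auto
  then show ?thesis
    by unfold_locales (simp only: borel_prod)
qed

lemma min_infdist_tendsto_indicator:
  fixes U :: "'a::metric_space set"
  assumes "open U" "U \<noteq> UNIV"
  shows "(\<lambda>n. min 1 (real n * infdist x (- U))) \<longlonglongrightarrow> indicator U x"
proof (cases "x \<in> U")
  case True
  then have "0 < infdist x (- U)"
    using assms in_closed_iff_infdist_zero[of "- U" x] infdist_nonneg[of x "- U"]
    by (auto simp: less_le)
  then obtain N :: nat where "1 \<le> real N * infdist x (- U)"
    using reals_Archimedean3 less_imp_le by blast
  then have "\<forall>\<^sub>F n in sequentially. 1 \<le> real n * infdist x (- U)"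
    by (intro eventually_sequentiallyI[of N])
       (erule order_trans, intro mult_right_mono infdist_nonneg, simp)
  then have "\<forall>\<^sub>F n in sequentially. min 1 (real n * infdist x (- U)) = indicator U x"
    by eventually_elim (simp add: True)
  then show ?thesis
    by (rule tendsto_eventually)
qed simp

lemma integral_min_infdist_tendsto_measure:
  fixes U :: "'a::metric_space set"
  assumes "borel_distribution M" "open U" "U \<noteq> UNIV"
  shows "(\<lambda>n. \<integral>x. min 1 (real n * infdist x (- U)) \<partial>M) \<longlonglongrightarrow> measure M U"
proof -
  interpret borel_distribution M by fact
  have [measurable]: "U \<in> events"
    using \<open>open U\<close> by simp
  have "(\<lambda>n. \<integral>x. min 1 (real n * infdist x (- U)) \<partial>M) \<longlonglongrightarrow> (\<integral>x. indicator U x \<partial>M)"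
  proof (rule integral_dominated_convergence[where w="\<lambda>_. 1"])
    show "(\<lambda>x. min 1 (real n * infdist x (- U))) \<in> borel_measurable M" for n
      by (intro borel_measurable_continuous continuous_intros)
    show "AE x in M. (\<lambda>n. min 1 (real n * infdist x (- U))) \<longlonglongrightarrow> indicator U x"
      using assms(2,3) by (intro AE_I2 min_infdist_tendsto_indicator)
    show "AE x in M. norm (min 1 (real n * infdist x (- U))) \<le> 1" for n
      by (simp add: infdist_nonneg)
  qed auto
  then show ?thesis
    by simp
qed

lemma borel_distribution_eqI:
  fixes M N :: "'a::metric_space measure"
  assumes M: "borel_distribution M" and N: "borel_distribution N"
    and eq: "\<And>f :: 'a \<Rightarrow> real. continuous_on UNIV f \<Longrightarrow> bounded (range f) \<Longrightarrow> (\<integral>x. f x \<partial>M) = (\<integral>x. f x \<partial>N)"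
  shows "M = N"
proof -
  interpret M: borel_distribution M by fact
  interpret N: borel_distribution N by fact
  have open_eq: "emeasure M U = emeasure N U" if "open U" for U
  proof (cases "U = UNIV")
    case True
    then show ?thesis
      using M.emeasure_space_1 N.emeasure_space_1 by simp
  next
    case False
    have "\<bar>min 1 (real n * infdist x (- U))\<bar> \<le> 1" for n x
      by (simp add: infdist_nonneg)
    then have "bounded (range (\<lambda>x. min 1 (real n * infdist x (- U))))" for n
      unfolding bounded_iff real_norm_def by blast
    then have "(\<integral>x. min 1 (real n * infdist x (- U)) \<partial>M) = (\<integral>x. min 1 (real n * infdist x (- U)) \<partial>N)" for n
      by (intro eq continuous_intros)
    then have "measure M U = measure N U"
      using integral_min_infdist_tendsto_measure[OF M that False] integral_min_infdist_tendsto_measure[OF N that False]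
      by (simp add: LIMSEQ_unique)
    then show ?thesis
      by (simp add: M.emeasure_eq_measure N.emeasure_eq_measure)
  qed
  show ?thesis
  proof (rule measure_eqI_generator_eq[where A="\<lambda>_. UNIV"])
    show "Int_stable {S :: 'a set. open S}"
      by (auto simp: Int_stable_def)
    show "sets M = sigma_sets UNIV {S. open S}" "sets N = sigma_sets UNIV {S. open S}"
      by (simp_all add: sets_borel)
  qed (auto simp: open_eq)
qed

section \<open>The continuity theorem for characteristic functions on Euclidean spaces\<close>

definition char_vec :: "'a::real_inner measure \<Rightarrow> 'a \<Rightarrow> complex" where
  "char_vec M t = (CLINT x|M. iexp (t \<bullet> x))"

lemma char_vec_real: "char_vec M t = char M t"
  by (simp add: char_vec_def char_def)

lemma char_distr_inner:
  fixes M :: "'a::real_inner measure"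
  assumes "borel_distribution M"
  shows "char (distr M borel (\<lambda>x. b \<bullet> x)) t = char_vec M (t *\<^sub>R b)"
proof -
  interpret borel_distribution M by fact
  show ?thesis
    unfolding char_def char_vec_def
    by (subst integral_distr) (auto intro!: borel_measurable_continuous continuous_intros)
qed

inductive_set trig_poly :: "('a::real_inner \<Rightarrow> real) set" where
  cos: "(\<lambda>x. a * cos (t \<bullet> x + c)) \<in> trig_poly"
| add: "f \<in> trig_poly \<Longrightarrow> g \<in> trig_poly \<Longrightarrow> (\<lambda>x. f x + g x) \<in> trig_poly"

lemma const_in_trig_poly: "(\<lambda>_. c) \<in> trig_poly"
  using trig_poly.cos[of c 0 0] by simp

lemma mult_in_trig_poly:
  assumes "f \<in> trig_poly" "g \<in> trig_poly"
  shows "(\<lambda>x. f x * g x) \<in> trig_poly"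
  using assms(1)
proof induction
  case (cos a t c)
  from assms(2) show ?case
  proof induction
    case (cos b s d)
    have "a * cos (t \<bullet> x + c) * (b * cos (s \<bullet> x + d))
        = a * b / 2 * cos ((t - s) \<bullet> x + (c - d)) + a * b / 2 * cos ((t + s) \<bullet> x + (c + d))" for x
    proof -
      have "(t - s) \<bullet> x + (c - d) = t \<bullet> x + c - (s \<bullet> x + d)"
        "(t + s) \<bullet> x + (c + d) = t \<bullet> x + c + (s \<bullet> x + d)"
        by (simp_all add: inner_diff_left inner_add_left)
      then show ?thesis
        by (simp only: cos_diff cos_add) (simp add: field_simps)
    qed
    then show ?case
      by (simp only: trig_poly.intros)
  next
    case (add g h)
    then show ?case
      using trig_poly.add[OF add.IH] by (simp add: distrib_left)
  qed
next
  case (add f h)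
  then show ?case
    using trig_poly.add[OF add.IH] by (simp add: distrib_right)
qed

lemma real_polynomial_function_in_trig_poly:
  fixes q :: "real \<Rightarrow> real"
  assumes "real_polynomial_function q" "f \<in> trig_poly"
  shows "(\<lambda>x. q (f x)) \<in> trig_poly"
  using assms(1)
proof induction
  case (linear q)
  then obtain c where "q = (\<lambda>x. x * c)"
    by (auto simp: real_bounded_linear)
  then show ?case
    using mult_in_trig_poly[OF assms(2) const_in_trig_poly] by simp
qed (simp_all add: const_in_trig_poly mult_in_trig_poly trig_poly.add)

lemma continuous_on_trig_poly: "f \<in> trig_poly \<Longrightarrow> continuous_on S f"
  by (induction rule: trig_poly.induct) (auto intro!: continuous_intros)

lemma bounded_range_trig_poly: "f \<in> trig_poly \<Longrightarrow> bounded (range f)"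
proof (induction rule: trig_poly.induct)
  case (cos a t c)
  have "\<bar>a * cos (t \<bullet> x + c)\<bar> \<le> \<bar>a\<bar>" for x
    by (simp add: abs_mult mult_left_le)
  then show ?case
    unfolding bounded_iff real_norm_def by blast
next
  case (add f g)
  then show ?case
    using bounded_plus_comp[of f UNIV g] by simp
qed

lemma trig_poly_separates_points:
  fixes x y :: "'a::real_inner"
  assumes "x \<noteq> y"
  shows "\<exists>f\<in>trig_poly. f x \<noteq> f y"
proof
  define t where "t = (pi / ((x - y) \<bullet> (x - y))) *\<^sub>R (x - y)"
  have "t \<bullet> x - t \<bullet> y = pi"
    using assms unfolding inner_diff_right[symmetric] by (simp add: t_def)
  then show "1 * cos (t \<bullet> x + - (t \<bullet> y)) \<noteq> 1 * cos (t \<bullet> y + - (t \<bullet> y))"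
    by simp
qed (rule trig_poly.cos)

lemma trig_poly_dense:
  fixes f :: "'a::real_inner \<Rightarrow> real"
  assumes "compact K" "continuous_on K f" "e > 0"
  obtains p where "p \<in> trig_poly" "\<And>x. x \<in> K \<Longrightarrow> \<bar>f x - p x\<bar> < e"
proof -
  interpret function_ring_on trig_poly K
    using assms(1)
    by unfold_locales (simp_all add: continuous_on_trig_poly trig_poly.add mult_in_trig_poly
        const_in_trig_poly trig_poly_separates_points)
  show ?thesis
    using Stone_Weierstrass_basic[OF assms(2,3)] that by blast
qed

text \<open>A trigonometric polynomial close to \<open>f\<close> on a cube may be large elsewhere. Its clipped version
  stays bounded and, by Weierstrass, is still a uniform limit of trigonometric polynomials.\<close>

definition clip :: "real \<Rightarrow> real \<Rightarrow> real" where
  "clip D y = max (- D) (min D y)"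

lemma abs_clip_le: "0 \<le> D \<Longrightarrow> \<bar>clip D y\<bar> \<le> D"
  by (auto simp: clip_def)

lemma abs_diff_clip_le: "\<bar>x\<bar> \<le> D \<Longrightarrow> \<bar>x - clip D y\<bar> \<le> \<bar>x - y\<bar>"
  by (auto simp: clip_def max_def min_def)

lemma continuous_on_clip [continuous_intros]:
  "continuous_on S f \<Longrightarrow> continuous_on S (\<lambda>x. clip D (f x))"
  unfolding clip_def by (intro continuous_intros)

lemma clip_trig_poly_approx:
  assumes "p \<in> trig_poly" "e > 0"
  obtains h where "h \<in> trig_poly" "\<And>x. \<bar>clip D (p x) - h x\<bar> < e"
proof -
  obtain B where B: "\<And>x. \<bar>p x\<bar> \<le> B"
    using bounded_range_trig_poly[OF assms(1)] unfolding bounded_iff by auto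
  have "continuous_on {- B..B} (clip D)"
    using continuous_on_clip[OF continuous_on_id] .
  then obtain q where poly: "real_polynomial_function q"
    and q: "\<And>y. y \<in> {- B..B} \<Longrightarrow> \<bar>clip D y - q y\<bar> < e"
    using Stone_Weierstrass_real_polynomial_function[OF compact_Icc _ \<open>e > 0\<close>] by blast
  show ?thesis
  proof
    show "(\<lambda>x. q (p x)) \<in> trig_poly"
      using poly assms(1) by (rule real_polynomial_function_in_trig_poly)
    show "\<bar>clip D (p x) - q (p x)\<bar> < e" for x
      using B[of x] by (intro q) auto
  qed
qed

lemma abs_integral_diff_le:
  fixes f h k :: "'a \<Rightarrow> real"
  assumes "integrable M f" "integrable M h" "integrable M k" and "\<And>x. \<bar>f x - h x\<bar> \<le> k x"
  shows "\<bar>(\<integral>x. f x \<partial>M) - (\<integral>x. h x \<partial>M)\<bar> \<le> (\<integral>x. k x \<partial>M)"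
proof -
  have "\<bar>(\<integral>x. f x \<partial>M) - (\<integral>x. h x \<partial>M)\<bar> = \<bar>\<integral>x. f x - h x \<partial>M\<bar>"
    using assms by simp
  also have "\<dots> \<le> (\<integral>x. \<bar>f x - h x\<bar> \<partial>M)"
    by (rule integral_abs_bound)
  also have "\<dots> \<le> (\<integral>x. k x \<partial>M)"
    using assms by (intro integral_mono) auto
  finally show ?thesis .
qed

locale borel_distributions =
  fixes M :: "nat \<Rightarrow> 'a::topological_space measure" and \<mu> :: "'a measure"
  assumes borel_distribution_seq: "\<And>n. borel_distribution (M n)"
    and borel_distribution_limit: "borel_distribution \<mu>"
begin

sublocale seq: borel_distribution "M n" for n
  by (rule borel_distribution_seq)

sublocale limit: borel_distribution \<mu>
  by (rule borel_distribution_limit)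

definition convergence_tests :: "('a \<Rightarrow> real) set" where
  "convergence_tests = {f. continuous_on UNIV f \<and> bounded (range f) \<and>
     (\<lambda>n. \<integral>x. f x \<partial>M n) \<longlonglongrightarrow> (\<integral>x. f x \<partial>\<mu>)}"

lemma convergence_testsD:
  assumes "f \<in> convergence_tests"
  shows "(\<lambda>n. \<integral>x. f x \<partial>M n) \<longlonglongrightarrow> (\<integral>x. f x \<partial>\<mu>)" "integrable (M n) f" "integrable \<mu> f"
  using assms
  by (auto simp: convergence_tests_def intro: seq.integrable_continuous_bounded limit.integrable_continuous_bounded)

lemma const_in_convergence_tests: "(\<lambda>_. c) \<in> convergence_tests"
  using seq.prob_space limit.prob_space
  by (simp add: convergence_tests_def del: seq.space_eq_UNIV limit.space_eq_UNIV)

lemma add_in_convergence_tests: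
  assumes "f \<in> convergence_tests" "g \<in> convergence_tests"
  shows "(\<lambda>x. f x + g x) \<in> convergence_tests"
proof -
  have "(\<lambda>n. \<integral>x. f x + g x \<partial>M n) \<longlonglongrightarrow> (\<integral>x. f x + g x \<partial>\<mu>)"
    using assms by (simp add: convergence_testsD tendsto_add)
  then show ?thesis
    using assms bounded_plus_comp[of f UNIV g]
    by (auto simp: convergence_tests_def intro: continuous_on_add)
qed

lemma cmult_in_convergence_tests:
  assumes "f \<in> convergence_tests"
  shows "(\<lambda>x. c * f x) \<in> convergence_tests"
proof -
  have "(\<lambda>n. \<integral>x. c * f x \<partial>M n) \<longlonglongrightarrow> (\<integral>x. c * f x \<partial>\<mu>)"
    using assms by (simp add: convergence_testsD tendsto_mult_left)
  then show ?thesis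
    using assms bounded_scaling[of "range f" c]
    by (auto simp: convergence_tests_def image_image intro: continuous_on_mult_left)
qed

lemma sum_in_convergence_tests:
  assumes "\<And>i. i \<in> I \<Longrightarrow> f i \<in> convergence_tests"
  shows "(\<lambda>x. \<Sum>i\<in>I. f i x) \<in> convergence_tests"
  using assms
  by (induction I rule: infinite_finite_induct)
     (simp_all add: const_in_convergence_tests add_in_convergence_tests)

lemma convergence_tests_approx:
  assumes cont: "continuous_on UNIV f" and bdd: "bounded (range f)"
    and approx: "\<And>e. e > 0 \<Longrightarrow> \<exists>h\<in>convergence_tests. \<exists>k\<in>convergence_tests.
      (\<forall>x. \<bar>f x - h x\<bar> \<le> k x) \<and> (\<integral>x. k x \<partial>\<mu>) < e"
  shows "f \<in> convergence_tests"
proof -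
  have "(\<lambda>n. \<integral>x. f x \<partial>M n) \<longlonglongrightarrow> (\<integral>x. f x \<partial>\<mu>)"
  proof (rule tendstoI)
    fix e :: real assume "e > 0"
    then obtain h k where h: "h \<in> convergence_tests" and k: "k \<in> convergence_tests"
      and fh: "\<And>x. \<bar>f x - h x\<bar> \<le> k x" and small: "(\<integral>x. k x \<partial>\<mu>) < e / 3"
      using approx[of "e / 3"] by auto
    have "\<forall>\<^sub>F n in sequentially. (\<integral>x. k x \<partial>M n) < e / 3"
      using convergence_testsD(1)[OF k] small by (rule order_tendstoD)
    moreover have "\<forall>\<^sub>F n in sequentially. dist (\<integral>x. h x \<partial>M n) (\<integral>x. h x \<partial>\<mu>) < e / 3"
      using convergence_testsD(1)[OF h] \<open>e > 0\<close> by (intro tendstoD) auto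
    ultimately show "\<forall>\<^sub>F n in sequentially. dist (\<integral>x. f x \<partial>M n) (\<integral>x. f x \<partial>\<mu>) < e"
    proof eventually_elim
      case (elim n)
      have "\<bar>(\<integral>x. f x \<partial>M n) - (\<integral>x. h x \<partial>M n)\<bar> \<le> (\<integral>x. k x \<partial>M n)"
        and "\<bar>(\<integral>x. f x \<partial>\<mu>) - (\<integral>x. h x \<partial>\<mu>)\<bar> \<le> (\<integral>x. k x \<partial>\<mu>)"
        using seq.integrable_continuous_bounded[OF cont bdd] limit.integrable_continuous_bounded[OF cont bdd]
          convergence_testsD(2,3)[OF h] convergence_testsD(2,3)[OF k]
        by (simp_all add: abs_integral_diff_le fh)
      with elim small show ?case
        unfolding dist_real_def by linarith
    qed
  qed
  with cont bdd show ?thesis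
    by (simp add: convergence_tests_def)
qed

end

locale char_convergence = borel_distributions M \<mu>
  for M :: "nat \<Rightarrow> 'a::euclidean_space measure" and \<mu> +
  assumes char_tendsto: "\<And>t. (\<lambda>n. char_vec (M n) t) \<longlonglongrightarrow> char_vec \<mu> t"
begin

lemma trig_poly_in_convergence_tests:
  assumes "f \<in> trig_poly"
  shows "f \<in> convergence_tests"
  using assms
proof induction
  case (cos a t c)
  have integral_cos: "(\<integral>x. a * cos (t \<bullet> x + c) \<partial>N) = a * Re (iexp c * char_vec N t)"
    if "borel_distribution N" for N
  proof -
    interpret borel_distribution N by fact
    have "integrable N (\<lambda>x. iexp (t \<bullet> x))"
      by (intro integrable_iexp borel_measurable_continuous continuous_intros) simp
    then have "Re (iexp c * char_vec N t) = (\<integral>x. Re (iexp c * iexp (t \<bullet> x)) \<partial>N)"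
      unfolding char_vec_def by (subst integral_Re) simp_all
    also have "\<dots> = (\<integral>x. cos (t \<bullet> x + c) \<partial>N)"
      by (simp add: cos_add Re_exp Im_exp mult.commute)
    finally show ?thesis
      by simp
  qed
  have "(\<lambda>n. \<integral>x. a * cos (t \<bullet> x + c) \<partial>M n) \<longlonglongrightarrow> (\<integral>x. a * cos (t \<bullet> x + c) \<partial>\<mu>)"
    unfolding integral_cos[OF borel_distribution_seq] integral_cos[OF borel_distribution_limit]
    by (intro tendsto_intros char_tendsto)
  then show ?case
    by (simp add: convergence_tests_def continuous_on_trig_poly bounded_range_trig_poly trig_poly.cos)
qed (rule add_in_convergence_tests)

lemma clip_trig_poly_in_convergence_tests:
  assumes "p \<in> trig_poly" "0 \<le> D"
  shows "(\<lambda>x. clip D (p x)) \<in> convergence_tests"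
proof (rule convergence_tests_approx)
  show "continuous_on UNIV (\<lambda>x. clip D (p x))"
    using continuous_on_trig_poly[OF assms(1)] by (rule continuous_on_clip)
  show "bounded (range (\<lambda>x. clip D (p x)))"
    using abs_clip_le[OF assms(2)] unfolding bounded_iff real_norm_def by blast
next
  fix e :: real assume "e > 0"
  then obtain h where "h \<in> trig_poly" "\<And>x. \<bar>clip D (p x) - h x\<bar> < e / 2"
    using clip_trig_poly_approx[OF assms(1), of "e / 2"] by auto
  then show "\<exists>h\<in>convergence_tests. \<exists>k\<in>convergence_tests.
      (\<forall>x. \<bar>clip D (p x) - h x\<bar> \<le> k x) \<and> (\<integral>x. k x \<partial>\<mu>) < e"
    using \<open>e > 0\<close> limit.prob_space
    by (intro bexI[of _ h] bexI[of _ "\<lambda>_. e / 2"] trig_poly_in_convergence_tests const_in_convergence_tests)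
       (simp_all add: less_imp_le del: limit.space_eq_UNIV)
qed

lemma inner_in_convergence_tests:
  fixes g :: "real \<Rightarrow> real"
  assumes "continuous_on UNIV g" "bounded (range g)"
  shows "(\<lambda>x. g (b \<bullet> x)) \<in> convergence_tests"
proof -
  let ?\<pi> = "\<lambda>x :: 'a. b \<bullet> x"
  have meas: "?\<pi> \<in> borel_measurable N" if "borel_distribution N" for N
    using that by (intro borel_distribution.borel_measurable_continuous continuous_intros)
  have rd: "real_distribution (distr N borel ?\<pi>)" if "borel_distribution N" for N
    using meas[OF that] that
    by (intro prob_space.real_distribution_distr borel_distribution.axioms)
  have "(\<lambda>n. char (distr (M n) borel ?\<pi>) t) \<longlonglongrightarrow> char (distr \<mu> borel ?\<pi>) t" for t
    by (simp add: char_distr_inner borel_distribution_seq borel_distribution_limit char_tendsto)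
  then have "weak_conv_m (\<lambda>n. distr (M n) borel ?\<pi>) (distr \<mu> borel ?\<pi>)"
    by (intro levy_continuity rd borel_distribution_seq borel_distribution_limit)
  moreover obtain B where "\<And>x. norm (g x) \<le> B"
    using assms(2) by (auto simp: bounded_iff)
  ultimately have "(\<lambda>n. \<integral>y. g y \<partial>distr (M n) borel ?\<pi>) \<longlonglongrightarrow> (\<integral>y. g y \<partial>distr \<mu> borel ?\<pi>)"
    using assms(1)
    by (intro weak_conv_imp_integral_bdd_continuous_conv rd borel_distribution_seq borel_distribution_limit)
       (auto simp: continuous_on_eq_continuous_at)
  moreover have "bounded (range (\<lambda>x. g (b \<bullet> x)))"
    using assms(2) by (rule bounded_subset) auto
  moreover have "continuous_on UNIV (\<lambda>x. g (b \<bullet> x))"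
    by (intro continuous_on_compose2[OF assms(1)] continuous_intros) auto
  ultimately show ?thesis
    using assms(1)
    by (simp add: convergence_tests_def borel_measurable_continuous_onI
        integral_distr[OF meas[OF borel_distribution_seq]] integral_distr[OF meas[OF borel_distribution_limit]])
qed

end

definition tail_weight :: "real \<Rightarrow> real \<Rightarrow> real" where
  "tail_weight T x = min 1 (\<bar>x\<bar> / T)"

lemma tail_weight_bounds:
  assumes "0 < T"
  shows "0 \<le> tail_weight T x" "tail_weight T x \<le> 1" "T \<le> \<bar>x\<bar> \<Longrightarrow> tail_weight T x = 1"
  using assms by (simp_all add: tail_weight_def)

lemma continuous_on_tail_weight [continuous_intros]:
  "0 < T \<Longrightarrow> continuous_on S f \<Longrightarrow> continuous_on S (\<lambda>x. tail_weight T (f x))"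
  unfolding tail_weight_def by (intro continuous_intros) auto

lemma bounded_range_tail_weight: "0 < T \<Longrightarrow> bounded (range (tail_weight T))"
  using tail_weight_bounds by (auto simp: bounded_iff intro!: exI[of _ 1])

definition cube_tail :: "real \<Rightarrow> 'a::euclidean_space \<Rightarrow> real" where
  "cube_tail T x = (\<Sum>b\<in>Basis. tail_weight T (b \<bullet> x))"

lemma cube_tail_real: "cube_tail T x = tail_weight T x"
  by (simp add: cube_tail_def)

lemma cube_tail_nonneg: "0 < T \<Longrightarrow> 0 \<le> cube_tail T x"
  by (simp add: cube_tail_def sum_nonneg tail_weight_bounds)

lemma cube_tail_ge_1:
  fixes x :: "'a::euclidean_space"
  assumes "0 < T" "x \<notin> cbox (- (T *\<^sub>R One)) (T *\<^sub>R One)"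
  shows "1 \<le> cube_tail T x"
proof -
  obtain b where "b \<in> Basis" "T \<le> \<bar>b \<bullet> x\<bar>"
    using assms(2) by (force simp: mem_box inner_commute[of x])
  then show ?thesis
    using tail_weight_bounds[OF assms(1)] member_le_sum[of b Basis "\<lambda>b. tail_weight T (b \<bullet> x)"]
    by (simp add: cube_tail_def)
qed

lemma integral_cube_tail_small:
  fixes M :: "'a::euclidean_space measure"
  assumes "borel_distribution M" "e > 0"
  obtains T where "0 < T" "(\<integral>x. cube_tail T x \<partial>M) < e"
proof -
  interpret borel_distribution M by fact
  have "(\<lambda>m. \<integral>x. cube_tail (real (Suc m)) x \<partial>M) \<longlonglongrightarrow> (\<integral>x. 0 \<partial>M)"
  proof (rule integral_dominated_convergence[where w="\<lambda>_. real DIM('a)"])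
    show "cube_tail (real (Suc m)) \<in> borel_measurable M" for m
      unfolding cube_tail_def by (intro borel_measurable_continuous continuous_intros) auto
    have "(\<lambda>m. \<Sum>b\<in>Basis. min 1 (\<bar>b \<bullet> x\<bar> * inverse (real (Suc m)))) \<longlonglongrightarrow> (\<Sum>b\<in>Basis. min 1 (\<bar>b \<bullet> x\<bar> * 0))" for x :: 'a
      by (intro tendsto_intros LIMSEQ_inverse_real_of_nat)
    then show "AE x in M. (\<lambda>m. cube_tail (real (Suc m)) x) \<longlonglongrightarrow> 0"
      by (simp add: cube_tail_def tail_weight_def divide_inverse)
    have "cube_tail (real (Suc m)) x \<le> (\<Sum>b\<in>(Basis :: 'a set). 1)" for m and x :: 'a
      unfolding cube_tail_def by (intro sum_mono tail_weight_bounds(2)) simp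
    then show "AE x in M. norm (cube_tail (real (Suc m)) x) \<le> real DIM('a)" for m
      by (simp add: cube_tail_nonneg)
  qed auto
  then have "\<forall>\<^sub>F m in sequentially. (\<integral>x. cube_tail (real (Suc m)) x \<partial>M) < e"
    using \<open>e > 0\<close> by (intro order_tendstoD) auto
  then obtain m where "(\<integral>x. cube_tail (real (Suc m)) x \<partial>M) < e"
    unfolding eventually_sequentially by blast
  then show ?thesis
    by (intro that[of "real (Suc m)"]) auto
qed

lemma clip_trig_poly_dense:
  fixes f :: "'a::euclidean_space \<Rightarrow> real"
  assumes cont: "continuous_on UNIV f" and D: "\<And>x. \<bar>f x\<bar> \<le> D" and "0 < T" "0 < e"
  obtains p where "p \<in> trig_poly" "\<And>x. \<bar>f x - clip D (p x)\<bar> \<le> e + 2 * D * cube_tail T x"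
proof -
  define K :: "'a set" where "K = cbox (- (T *\<^sub>R One)) (T *\<^sub>R One)"
  obtain p where "p \<in> trig_poly" and p: "\<And>x. x \<in> K \<Longrightarrow> \<bar>f x - p x\<bar> < e"
    using trig_poly_dense[of K f e] \<open>0 < e\<close> continuous_on_subset[OF cont] by (auto simp: K_def)
  have "0 \<le> D"
    using order_trans[OF abs_ge_zero D] .
  have "\<bar>f x - clip D (p x)\<bar> \<le> e + 2 * D * cube_tail T x" for x
  proof (cases "x \<in> K")
    case True
    have "\<bar>f x - clip D (p x)\<bar> \<le> \<bar>f x - p x\<bar>"
      using D by (rule abs_diff_clip_le)
    also have "\<dots> \<le> e"
      using p[OF True] by simp
    also have "\<dots> \<le> e + 2 * D * cube_tail T x"
      using cube_tail_nonneg[OF \<open>0 < T\<close>, of x] \<open>0 \<le> D\<close> by simp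
    finally show ?thesis .
  next
    case False
    have "\<bar>f x - clip D (p x)\<bar> \<le> \<bar>f x\<bar> + \<bar>clip D (p x)\<bar>"
      by (rule abs_triangle_ineq4)
    also have "\<dots> \<le> 2 * D * 1"
      using D[of x] abs_clip_le[OF \<open>0 \<le> D\<close>, of "p x"] by simp
    also have "\<dots> \<le> 2 * D * cube_tail T x"
      using cube_tail_ge_1[OF \<open>0 < T\<close>] False \<open>0 \<le> D\<close> by (intro mult_left_mono) (auto simp: K_def)
    finally show ?thesis
      using \<open>0 < e\<close> by simp
  qed
  with \<open>p \<in> trig_poly\<close> show ?thesis
    by (rule that)
qed

context char_convergence
begin

lemma cube_tail_in_convergence_tests:
  assumes "0 < T"
  shows "cube_tail T \<in> convergence_tests"
proof -
  have "(\<lambda>x. tail_weight T (b \<bullet> x)) \<in> convergence_tests" for b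
    using assms continuous_on_tail_weight[OF _ continuous_on_id]
    by (intro inner_in_convergence_tests[of "tail_weight T"] bounded_range_tail_weight) auto
  then show ?thesis
    unfolding cube_tail_def by (rule sum_in_convergence_tests)
qed

lemma continuous_bounded_in_convergence_tests:
  fixes f :: "'a \<Rightarrow> real"
  assumes f: "continuous_on UNIV f" "bounded (range f)"
  shows "f \<in> convergence_tests"
proof (rule convergence_tests_approx[OF f])
  fix e :: real assume "e > 0"
  obtain D where "D > 0" and D: "\<And>x. \<bar>f x\<bar> \<le> D"
    using f(2) by (auto simp: bounded_pos)
  obtain T where "T > 0" and T: "(\<integral>x. cube_tail T x \<partial>\<mu>) < e / (4 * D)"
    using integral_cube_tail_small[OF borel_distribution_limit, of "e / (4 * D)"] \<open>e > 0\<close> \<open>D > 0\<close> by auto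
  obtain p where p: "p \<in> trig_poly" and fp: "\<And>x. \<bar>f x - clip D (p x)\<bar> \<le> e / 2 + 2 * D * cube_tail T x"
    using clip_trig_poly_dense[OF f(1) D \<open>T > 0\<close>, of "e / 2"] \<open>e > 0\<close> by auto
  have "(\<integral>x. e / 2 + 2 * D * cube_tail T x \<partial>\<mu>) = e / 2 + 2 * D * (\<integral>x. cube_tail T x \<partial>\<mu>)"
    using limit.prob_space convergence_testsD(3)[OF cube_tail_in_convergence_tests[OF \<open>T > 0\<close>]]
    by (simp del: limit.space_eq_UNIV)
  also have "\<dots> < e"
    using T \<open>D > 0\<close> by (simp add: field_simps)
  finally show "\<exists>h\<in>convergence_tests. \<exists>k\<in>convergence_tests.
      (\<forall>x. \<bar>f x - h x\<bar> \<le> k x) \<and> (\<integral>x. k x \<partial>\<mu>) < e"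
    using clip_trig_poly_in_convergence_tests[OF p less_imp_le[OF \<open>D > 0\<close>]] fp
      cube_tail_in_convergence_tests[OF \<open>T > 0\<close>]
    by (intro bexI[of _ "\<lambda>x. clip D (p x)"] bexI[of _ "\<lambda>x. e / 2 + 2 * D * cube_tail T x"] conjI allI
        add_in_convergence_tests const_in_convergence_tests cmult_in_convergence_tests)
qed

end

theorem levy_continuity_euclidean:
  fixes M :: "nat \<Rightarrow> 'a::euclidean_space measure" and f :: "'a \<Rightarrow> real"
  assumes "\<And>n. borel_distribution (M n)" "borel_distribution \<mu>"
    and "\<And>t. (\<lambda>n. char_vec (M n) t) \<longlonglongrightarrow> char_vec \<mu> t"
    and "continuous_on UNIV f" "bounded (range f)"
  shows "(\<lambda>n. \<integral>x. f x \<partial>M n) \<longlonglongrightarrow> (\<integral>x. f x \<partial>\<mu>)"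
proof -
  interpret char_convergence M \<mu>
    by (intro char_convergence.intro borel_distributions.intro char_convergence_axioms.intro assms(1-3))
  show ?thesis
    by (rule convergence_testsD(1)[OF continuous_bounded_in_convergence_tests[OF assms(4,5)]])
qed

corollary Levy_uniqueness_euclidean:
  fixes M N :: "'a::euclidean_space measure"
  assumes "borel_distribution M" "borel_distribution N" "char_vec M = char_vec N"
  shows "M = N"
proof (rule borel_distribution_eqI)
  fix f :: "'a \<Rightarrow> real" assume "continuous_on UNIV f" "bounded (range f)"
  then have "(\<lambda>_. \<integral>x. f x \<partial>M) \<longlonglongrightarrow> (\<integral>x. f x \<partial>N)"
    using assms by (intro levy_continuity_euclidean) auto
  then show "(\<integral>x. f x \<partial>M) = (\<integral>x. f x \<partial>N)"
    by (simp add: LIMSEQ_const_iff)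
qed fact+

section \<open>Independence\<close>

lemma char_vec_pair:
  fixes K :: "'a::euclidean_space measure" and L :: "'b::euclidean_space measure"
  assumes "borel_distribution K" "borel_distribution L"
  shows "char_vec (K \<Otimes>\<^sub>M L) (s, t) = char_vec K s * char_vec L t"
proof -
  interpret K: borel_distribution K by fact
  interpret L: borel_distribution L by fact
  interpret pair_prob_space K L ..
  interpret KL: borel_distribution "K \<Otimes>\<^sub>M L"
    using assms by (rule borel_distribution_pair)
  have "integrable (K \<Otimes>\<^sub>M L) (\<lambda>z. iexp ((s, t) \<bullet> z))"
    by (intro integrable_iexp KL.borel_measurable_continuous continuous_intros) simp
  from integral_fst'[OF this]
  have "char_vec (K \<Otimes>\<^sub>M L) (s, t) = (CLINT x|K. CLINT y|L. iexp (s \<bullet> x) * iexp (t \<bullet> y))"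
    by (simp add: char_vec_def inner_Pair exp_add distrib_left)
  then show ?thesis
    by (simp add: char_vec_def)
qed

lemma (in prob_space) char_vec_distr:
  fixes X :: "'a \<Rightarrow> 'b::euclidean_space"
  assumes "X \<in> borel_measurable M"
  shows "char_vec (distr M borel X) t = (CLINT \<omega>|M. iexp (t \<bullet> X \<omega>))"
  unfolding char_vec_def using assms
  by (subst integral_distr) (auto intro!: borel_measurable_continuous_onI continuous_intros)

lemma (in prob_space) indep_var_char_vecI:
  fixes X Y :: "'a \<Rightarrow> 'b::euclidean_space"
  assumes [measurable]: "X \<in> borel_measurable M" "Y \<in> borel_measurable M"
    and char_eq: "\<And>s t. (CLINT \<omega>|M. iexp (s \<bullet> X \<omega> + t \<bullet> Y \<omega>))
      = (CLINT \<omega>|M. iexp (s \<bullet> X \<omega>)) * (CLINT \<omega>|M. iexp (t \<bullet> Y \<omega>))"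
  shows "indep_var borel X borel Y"
proof -
  let ?XY = "\<lambda>\<omega>. (X \<omega>, Y \<omega>)"
  have "distr M borel X \<Otimes>\<^sub>M distr M borel Y = distr M borel ?XY"
  proof (rule Levy_uniqueness_euclidean)
    show "borel_distribution (distr M borel X \<Otimes>\<^sub>M distr M borel Y)" "borel_distribution (distr M borel ?XY)"
      by (intro borel_distribution_pair borel_distribution_distr; measurable)+
    show "char_vec (distr M borel X \<Otimes>\<^sub>M distr M borel Y) = char_vec (distr M borel ?XY)"
    proof
      fix u :: "'b \<times> 'b"
      obtain s t where u: "u = (s, t)" by (cases u)
      show "char_vec (distr M borel X \<Otimes>\<^sub>M distr M borel Y) u = char_vec (distr M borel ?XY) u"
        unfolding u using char_eq[of s t]
        by (simp add: char_vec_pair borel_distribution_distr char_vec_distr inner_Pair)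
    qed
  qed
  then show ?thesis
    by (simp add: indep_var_distribution_eq borel_prod)
qed

lemma (in prob_space) integral_iexp_affine_indep:
  fixes X Y :: "'a \<Rightarrow> real"
  assumes indep: "indep_var borel X borel Y"
    and [measurable]: "g \<in> borel_measurable borel" "h \<in> borel_measurable borel"
  shows "(CLINT \<omega>|M. iexp (g (X \<omega>) + h (X \<omega>) * Y \<omega>))
    = (CLINT \<omega>|M. iexp (g (X \<omega>)) * char (distr M borel Y) (h (X \<omega>)))"
proof -
  have X [measurable]: "X \<in> borel_measurable M" and Y [measurable]: "Y \<in> borel_measurable M"
    using indep by (rule indep_var_rv1, rule indep_var_rv2)
  let ?K = "distr M borel X" and ?L = "distr M borel Y"
  let ?F = "\<lambda>(x, y). iexp (g x + h x * y)"
  have joint: "distr M (borel \<Otimes>\<^sub>M borel) (\<lambda>\<omega>. (X \<omega>, Y \<omega>)) = ?K \<Otimes>\<^sub>M ?L"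
    using indep by (simp add: indep_var_distribution_eq)
  interpret K: real_distribution ?K by (rule real_distribution_distr) fact
  interpret L: real_distribution ?L by (rule real_distribution_distr) fact
  interpret pair_prob_space ?K ?L ..
  have [measurable]: "?F \<in> borel_measurable (borel \<Otimes>\<^sub>M borel)"
    by measurable
  have "(CLINT \<omega>|M. iexp (g (X \<omega>) + h (X \<omega>) * Y \<omega>)) = (CLINT z|distr M (borel \<Otimes>\<^sub>M borel) (\<lambda>\<omega>. (X \<omega>, Y \<omega>)). ?F z)"
    by (subst integral_distr) simp_all
  also have "\<dots> = (CLINT z|?K \<Otimes>\<^sub>M ?L. ?F z)"
    unfolding joint ..
  also have "\<dots> = (CLINT x|?K. CLINT y|?L. ?F (x, y))"
    by (intro integral_fst'[symmetric] integrable_const_bound[where B=1])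
       (auto simp del: of_real_add of_real_mult)
  also have "\<dots> = (CLINT x|?K. iexp (g x) * char ?L (h x))"
    by (simp add: char_def exp_add distrib_left)
  also have "\<dots> = (CLINT \<omega>|M. iexp (g (X \<omega>)) * char ?L (h (X \<omega>)))"
    by (rule integral_distr) auto
  finally show ?thesis .
qed

lemma (in prob_space) indep_vars_integral_prod_bounded:
  fixes G :: "'i \<Rightarrow> 'b \<Rightarrow> complex"
  assumes I: "finite I" and indep: "indep_vars N W I"
    and meas: "\<And>i. i \<in> I \<Longrightarrow> G i \<in> borel_measurable (N i)" and bound: "\<And>i x. cmod (G i x) \<le> B"
  shows "(CLINT \<omega>|M. \<Prod>i\<in>I. G i (W i \<omega>)) = (\<Prod>i\<in>I. CLINT \<omega>|M. G i (W i \<omega>))"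
proof (rule indep_vars_lebesgue_integral[OF I])
  show "indep_vars (\<lambda>_. borel) (\<lambda>i \<omega>. G i (W i \<omega>)) I"
    using indep meas by (rule indep_vars_compose2)
  show "integrable M (\<lambda>\<omega>. G i (W i \<omega>))" if "i \<in> I" for i
  proof (rule integrable_const_bound[where B=B])
    have "W i \<in> measurable M (N i)"
      using indep that by (simp add: indep_vars_def)
    from measurable_compose[OF this meas[OF that]]
    show "(\<lambda>\<omega>. G i (W i \<omega>)) \<in> borel_measurable M" .
  qed (simp add: bound)
qed

lemma (in prob_space) variance_indep_add:
  assumes indep: "indep_var borel X borel Y"
    and X_sq: "integrable M (\<lambda>\<omega>. (X \<omega>)\<^sup>2)" and Y_sq: "integrable M (\<lambda>\<omega>. (Y \<omega>)\<^sup>2)"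
  shows "integrable M (\<lambda>\<omega>. (X \<omega> + Y \<omega>)\<^sup>2)"
    and "variance (\<lambda>\<omega>. X \<omega> + Y \<omega>) = variance X + variance (Y :: 'a \<Rightarrow> real)"
proof -
  have "X \<in> borel_measurable M" "Y \<in> borel_measurable M"
    using indep by (rule indep_var_rv1, rule indep_var_rv2)
  then have X: "integrable M X" and Y: "integrable M Y"
    using X_sq Y_sq by (auto intro: square_integrable_imp_integrable)
  note XY = indep_var_integrable[OF indep X Y]
  show sum_sq: "integrable M (\<lambda>\<omega>. (X \<omega> + Y \<omega>)\<^sup>2)"
    using X_sq Y_sq XY by (simp add: power2_sum mult.assoc)
  have "variance (\<lambda>\<omega>. X \<omega> + Y \<omega>) = expectation (\<lambda>\<omega>. (X \<omega> + Y \<omega>)\<^sup>2) - (expectation X + expectation Y)\<^sup>2"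
    using X Y sum_sq by (subst variance_eq) auto
  also have "expectation (\<lambda>\<omega>. (X \<omega> + Y \<omega>)\<^sup>2)
      = expectation (\<lambda>\<omega>. (X \<omega>)\<^sup>2) + expectation (\<lambda>\<omega>. (Y \<omega>)\<^sup>2) + 2 * (expectation X * expectation Y)"
    using X_sq Y_sq XY indep_var_lebesgue_integral[OF indep X Y] by (simp add: power2_sum mult.assoc)
  finally show "variance (\<lambda>\<omega>. X \<omega> + Y \<omega>) = variance X + variance Y"
    using X Y X_sq Y_sq by (simp add: variance_eq power2_sum)
qed

lemma (in prob_space) variance_indep_sum:
  fixes X :: "'i \<Rightarrow> 'a \<Rightarrow> real"
  assumes "finite I" "indep_vars (\<lambda>_. borel) X I"
    and "\<And>i. i \<in> I \<Longrightarrow> integrable M (\<lambda>\<omega>. (X i \<omega>)\<^sup>2)"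
  shows "integrable M (\<lambda>\<omega>. (\<Sum>i\<in>I. X i \<omega>)\<^sup>2) \<and> variance (\<lambda>\<omega>. \<Sum>i\<in>I. X i \<omega>) = (\<Sum>i\<in>I. variance (X i))"
  using assms
proof (induction I rule: finite_induct)
  case (insert i I)
  have "indep_vars (\<lambda>_. borel) X I"
    using insert.prems(1) by (rule indep_vars_subset) auto
  with insert variance_indep_add[OF indep_vars_sum[OF insert.hyps insert.prems(1)]]
  show ?case by simp
qed simp

section \<open>Gaussian laws\<close>

lemma real_distribution_normal_law:
  assumes "0 \<le> v"
  shows "real_distribution (normal_law v)"
proof (cases "v = 0")
  case True
  then show ?thesis
    by (auto simp: normal_law_def real_distribution_def real_distribution_axioms_def
        intro!: prob_space_return)
next
  case False
  then show ?thesis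
    using assms by (auto simp: normal_law_def real_distribution_def real_distribution_axioms_def
        intro!: prob_space_normal_density)
qed

lemma char_normal_law:
  assumes "0 \<le> v"
  shows "char (normal_law v) t = of_real (exp (- (v * t\<^sup>2) / 2))"
proof (cases "v = 0")
  case True
  then show ?thesis
    by (simp add: normal_law_def char_def integral_return)
next
  case False
  with assms have "v > 0" by simp
  interpret N: real_distribution std_normal_distribution
    by (rule real_dist_normal_dist)
  have "distributed std_normal_distribution lborel (\<lambda>x. x) std_normal_density"
    by (auto simp: distributed_def distr_id2)
  from N.normal_density_affine[OF this, of "sqrt v" 0] \<open>v > 0\<close>
  have "distributed std_normal_distribution lborel (\<lambda>x. sqrt v * x) (normal_density 0 (sqrt v))"
    by simp
  then have "normal_law v = distr std_normal_distribution lborel (\<lambda>x. sqrt v * x)"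
    using False by (simp add: normal_law_def distributed_def)
  also have "\<dots> = distr std_normal_distribution borel (\<lambda>x. sqrt v * x)"
    by (rule distr_cong) auto
  finally have "char (normal_law v) t = (CLINT x|std_normal_distribution. iexp (t * (sqrt v * x)))"
    unfolding char_def by (simp add: integral_distr)
  also have "\<dots> = char std_normal_distribution (t * sqrt v)"
    by (simp add: char_def mult.assoc)
  finally show ?thesis
    using \<open>v > 0\<close> by (simp add: char_std_normal_distribution power_mult_distrib mult.commute)
qed

lemma (in prob_space) distr_eq_normal_lawI:
  assumes "X \<in> borel_measurable M" "0 \<le> v"
    and "\<And>t. (CLINT \<omega>|M. iexp (t * X \<omega>)) = of_real (exp (- (v * t\<^sup>2) / 2))"
  shows "distr M borel X = normal_law v"
proof (rule Levy_uniqueness)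
  show "real_distribution (distr M borel X)" "real_distribution (normal_law v)"
    using assms(1,2) by (auto intro: real_distribution_normal_law)
  show "char (distr M borel X) = char (normal_law v)"
    using assms by (auto simp: char_def[of "distr M borel X"] integral_distr char_normal_law)
qed

lemma has_bochner_integral_normal_law_even:
  assumes "0 < v"
  shows "has_bochner_integral (normal_law v) (\<lambda>x. x ^ (2 * k)) (fact (2 * k) / ((2 / v) ^ k * fact k))"
  using normal_moment_even[of "sqrt v" 0 k] assms
  by (simp add: normal_law_def has_bochner_integral_density)

definition quad_form2 :: "real \<Rightarrow> real \<Rightarrow> real \<Rightarrow> real \<Rightarrow> real \<Rightarrow> real" where
  "quad_form2 v11 v12 v22 s t = s\<^sup>2 * v11 + 2 * s * t * v12 + t\<^sup>2 * v22"

lemma quad_form2_scale: "quad_form2 v11 v12 v22 (r * s) (r * t) = quad_form2 v11 v12 v22 s t * r\<^sup>2"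
  by (simp add: quad_form2_def power2_eq_square algebra_simps)

lemma quad_form2_cholesky:
  assumes psd: "\<And>s t. 0 \<le> quad_form2 v11 v12 v22 s t"
  obtains a b c where "\<And>s t. quad_form2 v11 v12 v22 s t = (s * a + t * b)\<^sup>2 + (t * c)\<^sup>2"
proof (cases "v11 = 0")
  case True
  have "v12 = 0"
  proof (rule ccontr)
    assume "v12 \<noteq> 0"
    then show False
      using psd[of "- (v22 + 1) / (2 * v12)" 1] True by (simp add: quad_form2_def field_simps)
  qed
  moreover have "0 \<le> v22"
    using psd[of 0 1] by (simp add: quad_form2_def)
  ultimately have "quad_form2 v11 v12 v22 s t = (s * 0 + t * 0)\<^sup>2 + (t * sqrt v22)\<^sup>2" for s t
    using True by (simp add: quad_form2_def power_mult_distrib)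
  then show ?thesis by (rule that)
next
  case False
  then have "0 < v11"
    using psd[of 1 0] by (simp add: quad_form2_def)
  have "0 \<le> v11 * (v11 * v22 - v12\<^sup>2)"
    using psd[of "- v12" v11] by (simp add: quad_form2_def power2_eq_square algebra_simps)
  with \<open>0 < v11\<close> have "0 \<le> v22 - v12\<^sup>2 / v11"
    by (simp add: zero_le_mult_iff field_simps)
  then have "quad_form2 v11 v12 v22 s t
      = (s * sqrt v11 + t * (v12 / sqrt v11))\<^sup>2 + (t * sqrt (v22 - v12\<^sup>2 / v11))\<^sup>2" for s t
    using \<open>0 < v11\<close>
    by (simp add: quad_form2_def power2_sum power_mult_distrib power_divide) (simp add: algebra_simps)
  then show ?thesis by (rule that)
qed

lemma gaussian2_iff_char_vec:
  assumes psd: "\<And>s t. 0 \<le> quad_form2 v11 v12 v22 s t"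
  shows "gaussian2 \<mu> v11 v12 v22 \<longleftrightarrow> borel_distribution \<mu> \<and>
    (\<forall>s t. char_vec \<mu> (s, t) = of_real (exp (- quad_form2 v11 v12 v22 s t / 2)))"
proof (cases "borel_distribution \<mu>")
  case True
  interpret borel_distribution \<mu> by fact
  let ?L = "\<lambda>s t. distr \<mu> borel (\<lambda>(x, y). s * x + t * y)"
  let ?N = "\<lambda>s t. normal_law (quad_form2 v11 v12 v22 s t)"
  have char_L: "char (?L s t) r = char_vec \<mu> (r * s, r * t)" for s t r
    using char_distr_inner[OF True, of "(s, t)" r] by (simp add: inner_prod_def case_prod_beta')
  have char_N: "char (?N s t) r = of_real (exp (- quad_form2 v11 v12 v22 (r * s) (r * t) / 2))" for s t r
    by (simp add: char_normal_law[OF psd] quad_form2_scale)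
  have "?L s t = ?N s t \<longleftrightarrow> char (?L s t) = char (?N s t)" for s t
  proof
    have "real_distribution (?L s t)"
      unfolding case_prod_beta
      by (intro real_distribution_distr borel_measurable_continuous continuous_intros)
    then show "?L s t = ?N s t" if "char (?L s t) = char (?N s t)"
      using real_distribution_normal_law[OF psd] that by (rule Levy_uniqueness)
  qed simp
  then have "gaussian2 \<mu> v11 v12 v22 \<longleftrightarrow> (\<forall>s t. char (?L s t) = char (?N s t))"
    using prob_space_axioms by (simp add: gaussian2_def quad_form2_def)
  also have "\<dots> \<longleftrightarrow> (\<forall>s t. char_vec \<mu> (s, t) = of_real (exp (- quad_form2 v11 v12 v22 s t / 2)))"
    unfolding fun_eq_iff char_L char_N by (metis mult_1)
  finally show ?thesis
    using True by simp
next
  case False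
  then show ?thesis
    by (auto simp: gaussian2_def borel_distribution_def borel_distribution_axioms_def)
qed

lemma gaussian2_exists:
  assumes psd: "\<And>s t. 0 \<le> quad_form2 v11 v12 v22 s t"
  shows "\<exists>\<mu>. gaussian2 \<mu> v11 v12 v22"
proof -
  obtain a b c where abc: "\<And>s t. quad_form2 v11 v12 v22 s t = (s * a + t * b)\<^sup>2 + (t * c)\<^sup>2"
    using quad_form2_cholesky[OF psd] by blast
  have std_normal: "borel_distribution (normal_law 1)"
    by (intro real_distribution.borel_distribution real_distribution_normal_law) simp
  define N where "N = normal_law 1 \<Otimes>\<^sub>M normal_law 1"
  interpret N: borel_distribution N
    unfolding N_def using std_normal std_normal by (rule borel_distribution_pair)
  define L :: "real \<times> real \<Rightarrow> real \<times> real" where "L z = (a * fst z, b * fst z + c * snd z)" for z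
  have L: "L \<in> borel_measurable N"
    unfolding L_def by (intro N.borel_measurable_continuous continuous_intros)
  have "char_vec (distr N borel L) (s, t) = char_vec N (s * a + t * b, t * c)" for s t
    unfolding N.char_vec_distr[OF L] by (simp add: char_vec_def L_def inner_prod_def algebra_simps)
  also have "\<dots> s t = of_real (exp (- quad_form2 v11 v12 v22 s t / 2))" for s t
    by (simp add: N_def char_vec_pair[OF std_normal std_normal] char_vec_real char_normal_law abc
        add_divide_distrib diff_divide_distrib flip: of_real_mult exp_add)
  finally have "gaussian2 (distr N borel L) v11 v12 v22"
    using L by (simp add: gaussian2_iff_char_vec[OF psd] N.borel_distribution_distr)
  then show ?thesis ..
qed

section \<open>Convergence and boundedness in probability\<close>

context prob_space
begin

definition tends_in_prob :: "(nat \<Rightarrow> 'a \<Rightarrow> 'b::metric_space) \<Rightarrow> 'b \<Rightarrow> bool" where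
  "tends_in_prob X c \<longleftrightarrow> (\<forall>e>0. (\<lambda>n. prob {\<omega> \<in> space M. e \<le> dist (X n \<omega>) c}) \<longlonglongrightarrow> 0)"

definition bdd_in_prob :: "(nat \<Rightarrow> 'a \<Rightarrow> real) \<Rightarrow> bool" where
  "bdd_in_prob Y \<longleftrightarrow> (\<forall>e>0. \<exists>K>0. \<forall>\<^sub>F n in sequentially. prob {\<omega> \<in> space M. K < \<bar>Y n \<omega>\<bar>} < e)"

lemma tends_in_probD:
  "tends_in_prob X c \<Longrightarrow> d > 0 \<Longrightarrow> e > 0 \<Longrightarrow>
    \<forall>\<^sub>F n in sequentially. prob {\<omega> \<in> space M. d \<le> dist (X n \<omega>) c} < e"
  unfolding tends_in_prob_def by (rule order_tendstoD(2)) auto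

lemma prob_tendsto_0_subset_Un:
  assumes sub: "\<forall>\<^sub>F n in sequentially. S n \<subseteq> A n \<union> B n"
    and [measurable]: "\<And>n. A n \<in> events" "\<And>n. B n \<in> events"
    and A: "(\<lambda>n. prob (A n)) \<longlonglongrightarrow> 0" and B: "(\<lambda>n. prob (B n)) \<longlonglongrightarrow> 0"
  shows "(\<lambda>n. prob (S n)) \<longlonglongrightarrow> 0"
proof (rule tendsto_sandwich[OF _ _ tendsto_const])
  show "(\<lambda>n. prob (A n) + prob (B n)) \<longlonglongrightarrow> 0"
    using tendsto_add[OF A B] by simp
  show "\<forall>\<^sub>F n in sequentially. prob (S n) \<le> prob (A n) + prob (B n)"
    using sub
  proof eventually_elim
    case (elim n)
    then have "prob (S n) \<le> prob (A n \<union> B n)"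
      by (intro finite_measure_mono) auto
    also have "\<dots> \<le> prob (A n) + prob (B n)"
      by (intro measure_Un_le) auto
    finally show ?case .
  qed
qed simp

lemma tends_in_prob_const:
  fixes c :: "'b :: metric_space"
  assumes "x \<longlonglongrightarrow> c"
  shows "tends_in_prob (\<lambda>n \<omega>. x n) c"
  unfolding tends_in_prob_def
proof (intro allI impI)
  fix e :: real assume "e > 0"
  have "\<forall>\<^sub>F n in sequentially. prob {\<omega> \<in> space M. e \<le> dist (x n) c} = 0"
    using tendstoD[OF assms \<open>e > 0\<close>] by eventually_elim simp
  then show "(\<lambda>n. prob {\<omega> \<in> space M. e \<le> dist (x n) c}) \<longlonglongrightarrow> 0"
    by (rule tendsto_eventually)
qed

lemma tends_in_prob_isCont2:
  fixes X :: "nat \<Rightarrow> 'a \<Rightarrow> 'b :: {metric_space, second_countable_topology}"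
    and Y :: "nat \<Rightarrow> 'a \<Rightarrow> 'c :: {metric_space, second_countable_topology}"
    and h :: "'b \<times> 'c \<Rightarrow> 'd :: metric_space"
  assumes [measurable]: "\<And>n. X n \<in> borel_measurable M" "\<And>n. Y n \<in> borel_measurable M"
    and X: "tends_in_prob X c" and Y: "tends_in_prob Y d" and "isCont h (c, d)"
  shows "tends_in_prob (\<lambda>n \<omega>. h (X n \<omega>, Y n \<omega>)) (h (c, d))"
  unfolding tends_in_prob_def
proof (intro allI impI)
  fix e :: real assume "e > 0"
  with \<open>isCont h (c, d)\<close> obtain r' where "r' > 0"
    and r': "\<And>z. dist z (c, d) < r' \<Longrightarrow> dist (h z) (h (c, d)) < e"
    unfolding continuous_at_eps_delta by blast
  define r where "r = r' / 2"
  have "r > 0"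
    using \<open>r' > 0\<close> by (simp add: r_def)
  have "dist x c < r \<Longrightarrow> dist y d < r \<Longrightarrow> dist (h (x, y)) (h (c, d)) < e" for x y
    using sqrt_sum_squares_le_sum[of "dist x c" "dist y d"] by (intro r') (simp add: dist_Pair_Pair r_def)
  then have sub: "{\<omega> \<in> space M. e \<le> dist (h (X n \<omega>, Y n \<omega>)) (h (c, d))}
      \<subseteq> {\<omega> \<in> space M. r \<le> dist (X n \<omega>) c} \<union> {\<omega> \<in> space M. r \<le> dist (Y n \<omega>) d}" for n
    by (fastforce simp flip: not_less)
  show "(\<lambda>n. prob {\<omega> \<in> space M. e \<le> dist (h (X n \<omega>, Y n \<omega>)) (h (c, d))}) \<longlonglongrightarrow> 0"
    by (rule prob_tendsto_0_subset_Un[OF always_eventually[OF allI[OF sub]]])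
       (use X Y \<open>r > 0\<close> in \<open>simp_all add: tends_in_prob_def\<close>)
qed

lemma tends_in_prob_isCont:
  fixes X :: "nat \<Rightarrow> 'a \<Rightarrow> 'b :: {metric_space, second_countable_topology}"
    and h :: "'b \<Rightarrow> 'c :: metric_space"
  assumes "\<And>n. X n \<in> borel_measurable M" "tends_in_prob X c" "isCont h c"
  shows "tends_in_prob (\<lambda>n \<omega>. h (X n \<omega>)) (h c)"
proof -
  have "isCont (\<lambda>z. h (fst z)) (c, c)"
    using isCont_o2[of "(c, c)" fst h] assms(3) by simp
  from tends_in_prob_isCont2[OF assms(1,1,2,2) this] show ?thesis
    by simp
qed

context
  fixes X Y :: "nat \<Rightarrow> 'a \<Rightarrow> real"
  assumes X_meas: "\<And>n. X n \<in> borel_measurable M" and Y_meas: "\<And>n. Y n \<in> borel_measurable M"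
begin

lemma tends_in_prob_add:
  "tends_in_prob X c \<Longrightarrow> tends_in_prob Y d \<Longrightarrow> tends_in_prob (\<lambda>n \<omega>. X n \<omega> + Y n \<omega>) (c + d)"
  using tends_in_prob_isCont2[OF X_meas Y_meas, where c=c and d=d and h="\<lambda>z. fst z + snd z"] by simp

lemma tends_in_prob_diff:
  "tends_in_prob X c \<Longrightarrow> tends_in_prob Y d \<Longrightarrow> tends_in_prob (\<lambda>n \<omega>. X n \<omega> - Y n \<omega>) (c - d)"
  using tends_in_prob_isCont2[OF X_meas Y_meas, where c=c and d=d and h="\<lambda>z. fst z - snd z"] by simp

lemma tends_in_prob_mult:
  "tends_in_prob X c \<Longrightarrow> tends_in_prob Y d \<Longrightarrow> tends_in_prob (\<lambda>n \<omega>. X n \<omega> * Y n \<omega>) (c * d)"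
  using tends_in_prob_isCont2[OF X_meas Y_meas, where c=c and d=d and h="\<lambda>z. fst z * snd z"] by simp

lemma tends_in_prob_divide:
  "tends_in_prob X c \<Longrightarrow> tends_in_prob Y d \<Longrightarrow> d \<noteq> 0 \<Longrightarrow>
    tends_in_prob (\<lambda>n \<omega>. X n \<omega> / Y n \<omega>) (c / d)"
  using tends_in_prob_isCont2[OF X_meas Y_meas, where c=c and d=d and h="\<lambda>z. fst z / snd z"] by simp

lemma tends_in_prob_0_mult_bdd:
  assumes X: "tends_in_prob X 0" and Y: "bdd_in_prob Y"
  shows "tends_in_prob (\<lambda>n \<omega>. X n \<omega> * Y n \<omega>) 0"
  unfolding tends_in_prob_def
proof (intro allI impI order_tendstoI)
  fix d e :: real assume "d > 0" "e > 0"
  note [measurable] = X_meas Y_meas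
  obtain K where "K > 0" and K: "\<forall>\<^sub>F n in sequentially. prob {\<omega> \<in> space M. K < \<bar>Y n \<omega>\<bar>} < e / 2"
    using Y \<open>e > 0\<close> unfolding bdd_in_prob_def by (meson half_gt_zero)
  have "\<forall>\<^sub>F n in sequentially. prob {\<omega> \<in> space M. d / K \<le> dist (X n \<omega>) 0} < e / 2"
    using X \<open>K > 0\<close> \<open>d > 0\<close> \<open>e > 0\<close> by (intro tends_in_probD) auto
  with K show "\<forall>\<^sub>F n in sequentially. prob {\<omega> \<in> space M. d \<le> dist (X n \<omega> * Y n \<omega>) 0} < e"
  proof eventually_elim
    case (elim n)
    let ?A = "{\<omega> \<in> space M. d / K \<le> dist (X n \<omega>) 0}" and ?B = "{\<omega> \<in> space M. K < \<bar>Y n \<omega>\<bar>}"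
    have "d / K \<le> \<bar>x\<bar>" if "d \<le> \<bar>x * y\<bar>" "\<bar>y\<bar> \<le> K" for x y
    proof -
      have "\<bar>x * y\<bar> \<le> \<bar>x\<bar> * K"
        unfolding abs_mult using that by (intro mult_left_mono) auto
      with that \<open>K > 0\<close> show ?thesis by (simp add: field_simps)
    qed
    then have "{\<omega> \<in> space M. d \<le> dist (X n \<omega> * Y n \<omega>) 0} \<subseteq> ?A \<union> ?B"
      by (auto simp: not_less)
    then have "prob {\<omega> \<in> space M. d \<le> dist (X n \<omega> * Y n \<omega>) 0} \<le> prob (?A \<union> ?B)"
      by (intro finite_measure_mono) auto
    also have "\<dots> \<le> prob ?A + prob ?B"
      by (intro measure_Un_le) auto
    finally show ?case
      using elim by simp
  qed
qed (simp add: less_le_trans)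

end

lemma tends_in_prob_mult_bdd:
  fixes X Y :: "nat \<Rightarrow> 'a \<Rightarrow> real"
  assumes "\<And>n. X n \<in> borel_measurable M" "\<And>n. Y n \<in> borel_measurable M"
    and "tends_in_prob X c" "bdd_in_prob Y"
  shows "tends_in_prob (\<lambda>n \<omega>. X n \<omega> * Y n \<omega> - c * Y n \<omega>) 0"
proof -
  have "tends_in_prob (\<lambda>n \<omega>. X n \<omega> - c) 0"
    using tends_in_prob_diff[OF assms(1) _ assms(3) tends_in_prob_const[OF tendsto_const[of c]]] by simp
  from tends_in_prob_0_mult_bdd[OF _ assms(2) this assms(4)] show ?thesis
    using assms(1) by (simp add: left_diff_distrib)
qed

lemma tends_in_prob_transform:
  assumes [measurable]: "\<And>n. X n \<in> borel_measurable M" "\<And>n. S n \<in> events"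
    and X: "tends_in_prob X (c :: 'b :: {metric_space, second_countable_topology})"
    and S: "(\<lambda>n. prob (S n)) \<longlonglongrightarrow> 0"
    and eq: "\<forall>\<^sub>F n in sequentially. \<forall>\<omega> \<in> space M - S n. Y n \<omega> = X n \<omega>"
  shows "tends_in_prob Y c"
  unfolding tends_in_prob_def
proof (intro allI impI)
  fix e :: real assume "e > 0"
  from eq have "\<forall>\<^sub>F n in sequentially.
      {\<omega> \<in> space M. e \<le> dist (Y n \<omega>) c} \<subseteq> S n \<union> {\<omega> \<in> space M. e \<le> dist (X n \<omega>) c}"
    by eventually_elim auto
  then show "(\<lambda>n. prob {\<omega> \<in> space M. e \<le> dist (Y n \<omega>) c}) \<longlonglongrightarrow> 0"
    by (rule prob_tendsto_0_subset_Un) (use X S \<open>e > 0\<close> in \<open>simp_all add: tends_in_prob_def\<close>)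
qed

lemma tends_in_prob_imp_prob_eq_tendsto_0:
  fixes X :: "nat \<Rightarrow> 'a \<Rightarrow> 'b :: {metric_space, second_countable_topology}"
  assumes [measurable]: "\<And>n. X n \<in> borel_measurable M" and "tends_in_prob X c" "c \<noteq> d"
  shows "(\<lambda>n. prob {\<omega> \<in> space M. X n \<omega> = d}) \<longlonglongrightarrow> 0"
proof (rule tendsto_sandwich[OF _ _ tendsto_const])
  show "(\<lambda>n. prob {\<omega> \<in> space M. dist d c \<le> dist (X n \<omega>) c}) \<longlonglongrightarrow> 0"
    using assms by (simp add: tends_in_prob_def)
  show "\<forall>\<^sub>F n in sequentially. prob {\<omega> \<in> space M. X n \<omega> = d} \<le> prob {\<omega> \<in> space M. dist d c \<le> dist (X n \<omega>) c}"
    by (intro always_eventually allI finite_measure_mono) auto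
qed simp

lemma tends_in_prob_0_expectation_norm:
  fixes X :: "nat \<Rightarrow> 'a \<Rightarrow> 'b :: {real_normed_vector, second_countable_topology}"
  assumes [measurable]: "\<And>n. X n \<in> borel_measurable M"
    and X: "tends_in_prob X 0" and bound: "\<And>n \<omega>. norm (X n \<omega>) \<le> B"
  shows "(\<lambda>n. expectation (\<lambda>\<omega>. norm (X n \<omega>))) \<longlonglongrightarrow> 0"
proof (rule tendstoI)
  fix e :: real assume "e > 0"
  have "B \<ge> 0"
    using norm_ge_zero bound by (rule order_trans)
  have "\<forall>\<^sub>F n in sequentially. prob {\<omega> \<in> space M. e / 2 \<le> dist (X n \<omega>) 0} < e / (2 * (B + 1))"
    using X \<open>e > 0\<close> \<open>B \<ge> 0\<close> by (intro tends_in_probD) auto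
  then show "\<forall>\<^sub>F n in sequentially. dist (expectation (\<lambda>\<omega>. norm (X n \<omega>))) 0 < e"
  proof eventually_elim
    case (elim n)
    let ?A = "{\<omega> \<in> space M. e / 2 \<le> dist (X n \<omega>) 0}"
    have "expectation (\<lambda>\<omega>. norm (X n \<omega>)) \<le> expectation (\<lambda>\<omega>. e / 2 + B * indicator ?A \<omega>)"
    proof (rule integral_mono)
      show "integrable M (\<lambda>\<omega>. norm (X n \<omega>))"
        using bound by (intro integrable_const_bound[where B=B]) auto
      show "integrable M (\<lambda>\<omega>. e / 2 + B * indicator ?A \<omega>)"
        by (auto simp: less_top[symmetric])
      show "norm (X n \<omega>) \<le> e / 2 + B * indicator ?A \<omega>" if "\<omega> \<in> space M" for \<omega>
        using bound[of n \<omega>] that \<open>e > 0\<close> by (auto split: split_indicator)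
    qed
    also have "\<dots> = e / 2 + B * prob ?A"
      by (simp add: less_top[symmetric] prob_space)
    also have "\<dots> \<le> e / 2 + B * (e / (2 * (B + 1)))"
      using elim \<open>B \<ge> 0\<close> by (intro add_left_mono mult_left_mono) auto
    also have "\<dots> < e"
      using \<open>B \<ge> 0\<close> \<open>e > 0\<close> by (simp add: field_simps)
    finally show ?case
      by (simp add: integral_nonneg_AE)
  qed
qed

lemma tends_in_prob_integral_mult:
  fixes U W :: "nat \<Rightarrow> 'a \<Rightarrow> complex"
  assumes [measurable]: "\<And>n. U n \<in> borel_measurable M" "\<And>n. W n \<in> borel_measurable M"
    and U: "\<And>n \<omega>. cmod (U n \<omega>) \<le> 1" and W: "tends_in_prob W c" "\<And>n \<omega>. cmod (W n \<omega>) \<le> B"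
  shows "(\<lambda>n. (CLINT \<omega>|M. U n \<omega> * W n \<omega>) - (CLINT \<omega>|M. U n \<omega>) * c) \<longlonglongrightarrow> 0"
proof (rule Lim_null_comparison)
  have diff_bound: "cmod (W n \<omega> - c) \<le> B + cmod c" for n \<omega>
    using norm_triangle_ineq4[of "W n \<omega>" c] W(2)[of n \<omega>] by linarith
  have "tends_in_prob (\<lambda>n \<omega>. W n \<omega> - c) 0"
    using W(1) by (simp add: tends_in_prob_def dist_norm)
  then show "(\<lambda>n. expectation (\<lambda>\<omega>. cmod (W n \<omega> - c))) \<longlonglongrightarrow> 0"
    using diff_bound by (intro tends_in_prob_0_expectation_norm) auto
  have U_int: "integrable M (U n)" for n
    using U by (intro integrable_const_bound[where B=1]) auto
  have W_int: "integrable M (W n)" for n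
    using W(2) by (intro integrable_const_bound[where B=B]) auto
  have UW_int: "integrable M (\<lambda>\<omega>. U n \<omega> * W n \<omega>)" for n
    using U by (intro Bochner_Integration.integrable_bound[OF W_int[of n]]) (auto simp: norm_mult mult_left_le_one_le)
  have "cmod ((CLINT \<omega>|M. U n \<omega> * W n \<omega>) - (CLINT \<omega>|M. U n \<omega>) * c) \<le> expectation (\<lambda>\<omega>. cmod (W n \<omega> - c))" for n
  proof -
    have "(CLINT \<omega>|M. U n \<omega> * W n \<omega>) - (CLINT \<omega>|M. U n \<omega>) * c = (CLINT \<omega>|M. U n \<omega> * (W n \<omega> - c))"
      using U_int UW_int by (simp add: right_diff_distrib)
    also have "cmod \<dots> \<le> expectation (\<lambda>\<omega>. cmod (W n \<omega> - c))"
    proof (intro order_trans[OF integral_norm_bound] integral_mono)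
      show "integrable M (\<lambda>\<omega>. cmod (U n \<omega> * (W n \<omega> - c)))" "integrable M (\<lambda>\<omega>. cmod (W n \<omega> - c))"
        using U_int UW_int W_int by (simp_all add: right_diff_distrib)
      show "cmod (U n \<omega> * (W n \<omega> - c)) \<le> cmod (W n \<omega> - c)" for \<omega>
        using U by (simp add: norm_mult mult_left_le_one_le)
    qed
    finally show ?thesis .
  qed
  then show "\<forall>\<^sub>F n in sequentially. cmod ((CLINT \<omega>|M. U n \<omega> * W n \<omega>) - (CLINT \<omega>|M. U n \<omega>) * c)
      \<le> expectation (\<lambda>\<omega>. cmod (W n \<omega> - c))"
    by simp
qed

lemma integral_iexp_diff_tendsto_0:
  fixes X Y :: "nat \<Rightarrow> 'a \<Rightarrow> real"
  assumes [measurable]: "\<And>n. X n \<in> borel_measurable M" "\<And>n. Y n \<in> borel_measurable M"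
    and diff: "tends_in_prob (\<lambda>n \<omega>. X n \<omega> - Y n \<omega>) 0"
  shows "(\<lambda>n. (CLINT \<omega>|M. iexp (X n \<omega>)) - (CLINT \<omega>|M. iexp (Y n \<omega>))) \<longlonglongrightarrow> 0"
proof -
  have "tends_in_prob (\<lambda>n \<omega>. iexp (X n \<omega> - Y n \<omega>)) (iexp 0)"
    by (rule tends_in_prob_isCont[OF _ diff]) (auto intro!: continuous_intros)
  then have "(\<lambda>n. (CLINT \<omega>|M. iexp (Y n \<omega>) * iexp (X n \<omega> - Y n \<omega>)) - (CLINT \<omega>|M. iexp (Y n \<omega>)) * iexp 0) \<longlonglongrightarrow> 0"
    by (rule tends_in_prob_integral_mult[where B=1, rotated 3]) (auto simp del: of_real_diff)
  moreover have "iexp (Y n \<omega>) * iexp (X n \<omega> - Y n \<omega>) = iexp (X n \<omega>)" for n \<omega>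
    by (simp add: algebra_simps flip: exp_add)
  ultimately show ?thesis
    by simp
qed

lemma prob_abs_gt_le_tail_weight:
  assumes [measurable]: "Y \<in> borel_measurable M" and "0 < T"
  shows "prob {\<omega> \<in> space M. T < \<bar>Y \<omega>\<bar>} \<le> expectation (\<lambda>\<omega>. tail_weight T (Y \<omega>))"
proof -
  have [measurable]: "tail_weight T \<in> borel_measurable borel"
    unfolding tail_weight_def by measurable
  have "prob {\<omega> \<in> space M. T < \<bar>Y \<omega>\<bar>} = expectation (indicator {\<omega> \<in> space M. T < \<bar>Y \<omega>\<bar>})"
    by simp
  also have "\<dots> \<le> expectation (\<lambda>\<omega>. tail_weight T (Y \<omega>))"
    using tail_weight_bounds[OF \<open>0 < T\<close>]
    by (intro integral_mono) (auto simp: less_top[symmetric] split: split_indicator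
        intro!: integrable_const_bound[where B=1])
  finally show ?thesis .
qed

lemma bdd_in_prob_char_tendsto:
  assumes [measurable]: "\<And>n. Y n \<in> borel_measurable M" and "real_distribution N"
    and lim: "\<And>t. (\<lambda>n. CLINT \<omega>|M. iexp (t * Y n \<omega>)) \<longlonglongrightarrow> char N t"
  shows "bdd_in_prob Y"
  unfolding bdd_in_prob_def
proof (intro allI impI)
  fix e :: real assume "e > 0"
  interpret N: real_distribution N by fact
  obtain T where "T > 0" and T: "(\<integral>x. tail_weight T x \<partial>N) < e"
    using integral_cube_tail_small[OF N.borel_distribution \<open>e > 0\<close>] unfolding cube_tail_real by blast
  have cont: "continuous_on UNIV (tail_weight T)"
    using \<open>T > 0\<close> continuous_on_id by (rule continuous_on_tail_weight)
  have "char (distr M borel (Y n)) t = (CLINT \<omega>|M. iexp (t * Y n \<omega>))" for n t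
    unfolding char_def by (subst integral_distr) auto
  then have "weak_conv_m (\<lambda>n. distr M borel (Y n)) N"
    using lim assms(2) by (intro levy_continuity) auto
  then have "(\<lambda>n. \<integral>x. tail_weight T x \<partial>distr M borel (Y n)) \<longlonglongrightarrow> (\<integral>x. tail_weight T x \<partial>N)"
    using tail_weight_bounds[OF \<open>T > 0\<close>] assms(2) cont
    by (intro weak_conv_imp_integral_bdd_continuous_conv[where B=1]) (auto simp: continuous_on_eq_continuous_at)
  then have "\<forall>\<^sub>F n in sequentially. expectation (\<lambda>\<omega>. tail_weight T (Y n \<omega>)) < e"
    using T by (intro order_tendstoD) (simp_all add: integral_distr borel_measurable_continuous_onI[OF cont])
  then have "\<forall>\<^sub>F n in sequentially. prob {\<omega> \<in> space M. T < \<bar>Y n \<omega>\<bar>} < e"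
    by eventually_elim (rule le_less_trans[OF prob_abs_gt_le_tail_weight[OF assms(1) \<open>T > 0\<close>]])
  with \<open>T > 0\<close> show "\<exists>K>0. \<forall>\<^sub>F n in sequentially. prob {\<omega> \<in> space M. K < \<bar>Y n \<omega>\<bar>} < e"
    by blast
qed

lemma bdd_in_prob_normal_limit:
  assumes "\<And>n. Y n \<in> borel_measurable M" "0 \<le> v"
    and "\<And>t. (\<lambda>n. CLINT \<omega>|M. iexp (t * Y n \<omega>)) \<longlonglongrightarrow> of_real (exp (- (v * t\<^sup>2) / 2))"
  shows "bdd_in_prob Y"
  using assms(1) real_distribution_normal_law[OF assms(2)]
  by (rule bdd_in_prob_char_tendsto) (simp only: char_normal_law[OF assms(2)] assms(3))

lemma sqrt_bdd_in_prob_imp_tends_in_prob_0: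
  assumes [measurable]: "\<And>n. X n \<in> borel_measurable M"
    and bdd: "bdd_in_prob (\<lambda>n \<omega>. sqrt (real n) * X n \<omega>)"
  shows "tends_in_prob X 0"
proof -
  have "(\<lambda>n. 1 / sqrt (real n)) \<longlonglongrightarrow> 0"
    by (intro tendsto_divide_0[OF tendsto_const] filterlim_at_top_imp_at_infinity
        filterlim_compose[OF sqrt_at_top filterlim_real_sequentially])
  note lim = tends_in_prob_const[OF this]
  have "tends_in_prob (\<lambda>n \<omega>. 1 / sqrt (real n) * (sqrt (real n) * X n \<omega>)) 0"
    by (rule tends_in_prob_0_mult_bdd[OF _ _ lim bdd]) measurable
  then show ?thesis
  proof (rule tends_in_prob_transform[rotated 2])
    show "\<forall>\<^sub>F n in sequentially. \<forall>\<omega>\<in>space M - {}. X n \<omega> = 1 / sqrt (real n) * (sqrt (real n) * X n \<omega>)"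
      using eventually_gt_at_top[of 0] by eventually_elim simp
  qed auto
qed

lemma sample_mean_deviation_bound:
  fixes X :: "nat \<Rightarrow> 'a \<Rightarrow> real"
  assumes indep: "indep_vars (\<lambda>_. borel) X {..<n}"
    and sq_int: "\<And>j. j < n \<Longrightarrow> integrable M (\<lambda>\<omega>. (X j \<omega>)\<^sup>2)"
    and mean: "\<And>j. j < n \<Longrightarrow> expectation (X j) = m" and var: "\<And>j. j < n \<Longrightarrow> variance (X j) \<le> s"
    and "0 < n" "0 < e"
  shows "prob {\<omega> \<in> space M. e \<le> dist ((\<Sum>j<n. X j \<omega>) / n) m} \<le> s / e\<^sup>2 * (1 / n)"
proof -
  have X_meas: "X j \<in> borel_measurable M" if "j < n" for j
    using indep that by (simp add: indep_vars_def)
  then have int: "integrable M (X j)" if "j < n" for j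
    using sq_int that by (blast intro: square_integrable_imp_integrable)
  let ?S = "\<lambda>\<omega>. \<Sum>j<n. X j \<omega>"
  have S_meas: "?S \<in> borel_measurable M"
    using X_meas by (intro borel_measurable_sum) auto
  have sum: "integrable M (\<lambda>\<omega>. (?S \<omega>)\<^sup>2)" "variance ?S = (\<Sum>j<n. variance (X j))"
    using variance_indep_sum[OF finite_lessThan indep] sq_int by auto
  have mean_sum: "expectation ?S = n * m"
    using int by (simp add: mean)
  have "x / n - m = (x - n * m) / n" for x :: real
    using \<open>0 < n\<close> by (simp add: diff_divide_distrib)
  then have "dist (x / n) m = \<bar>x - n * m\<bar> / n" for x :: real
    by (simp add: dist_real_def abs_divide)
  then have "{\<omega> \<in> space M. e \<le> dist (?S \<omega> / n) m} = {\<omega> \<in> space M. e * n \<le> \<bar>?S \<omega> - expectation ?S\<bar>}"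
    using \<open>0 < n\<close> by (simp add: mean_sum pos_le_divide_eq)
  also have "prob \<dots> \<le> variance ?S / (e * n)\<^sup>2"
    using S_meas sum(1) assms(5,6) by (intro Chebyshev_inequality) auto
  also have "\<dots> \<le> (n * s) / (e * n)\<^sup>2"
    unfolding sum(2) using sum_mono[of "{..<n}" "\<lambda>j. variance (X j)" "\<lambda>_. s"] var
    by (intro divide_right_mono) auto
  also have "\<dots> = s / e\<^sup>2 * (1 / n)"
    using \<open>0 < n\<close> by (simp add: power2_eq_square)
  finally show ?thesis .
qed

lemma weak_law_of_large_numbers:
  fixes X :: "nat \<Rightarrow> 'a \<Rightarrow> real"
  assumes indep: "indep_vars (\<lambda>_. borel) X UNIV"
    and "\<And>j. integrable M (\<lambda>\<omega>. (X j \<omega>)\<^sup>2)"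
    and "\<And>j. expectation (X j) = m" and "\<And>j. variance (X j) \<le> s"
  shows "tends_in_prob (\<lambda>n \<omega>. (\<Sum>j<n. X j \<omega>) / n) m"
  unfolding tends_in_prob_def
proof (intro allI impI)
  fix e :: real assume "e > 0"
  have bound: "\<forall>\<^sub>F n in sequentially.
      prob {\<omega> \<in> space M. e \<le> dist ((\<Sum>j<n. X j \<omega>) / n) m} \<le> s / e\<^sup>2 * (1 / n)"
    using eventually_gt_at_top[of 0]
    by eventually_elim
       (rule sample_mean_deviation_bound[OF indep_vars_subset[OF indep subset_UNIV] assms(2-4) _ \<open>e > 0\<close>])
  have lim: "(\<lambda>n. s / e\<^sup>2 * (1 / real n)) \<longlonglongrightarrow> 0"
    using tendsto_mult_right_zero[OF lim_1_over_n] by blast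
  show "(\<lambda>n. prob {\<omega> \<in> space M. e \<le> dist ((\<Sum>j<n. X j \<omega>) / n) m}) \<longlonglongrightarrow> 0"
    by (rule tendsto_sandwich[OF _ bound tendsto_const lim]) simp
qed

end

section \<open>Quadratic statistics of a Gaussian error array\<close>

lemma iexp_sum: "iexp (\<Sum>j\<in>I. x j) = (\<Prod>j\<in>I. iexp (x j))"
  by (induction I rule: infinite_finite_induct) (simp_all add: distrib_left exp_add)

lemma sqrt_mult_divide_self: "0 \<le> y \<Longrightarrow> sqrt y * (a * (x / y)) = a * x / sqrt y"
  by (cases "y = 0") (simp_all add: field_simps flip: power2_eq_square)

locale gaussian_error_array = prob_space M for M :: "'a measure" +
  fixes E F :: "nat \<Rightarrow> 'a \<Rightarrow> real" and Z :: "nat \<Rightarrow> nat \<Rightarrow> real" and v w q :: real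
  assumes indep: "indep_vars (\<lambda>_. borel) (\<lambda>j \<omega>. (E j \<omega>, F j \<omega>)) UNIV"
    and indep_EF: "\<And>j. indep_var borel (E j) borel (F j)"
    and distr_E: "\<And>j. distr M borel (E j) = normal_law v"
    and distr_F: "\<And>j. distr M borel (F j) = normal_law w"
    and v_pos: "0 < v" and w_nonneg: "0 \<le> w" and q_pos: "0 < q"
    and Z_lim: "(\<lambda>n. (\<Sum>j<n. (Z n j)\<^sup>2) / n) \<longlonglongrightarrow> q"
begin

definition zz :: "nat \<Rightarrow> real" where "zz n = (\<Sum>j<n. (Z n j)\<^sup>2) / n"
definition ze :: "nat \<Rightarrow> 'a \<Rightarrow> real" where "ze n \<omega> = (\<Sum>j<n. Z n j * E j \<omega>) / n"
definition zf :: "nat \<Rightarrow> 'a \<Rightarrow> real" where "zf n \<omega> = (\<Sum>j<n. Z n j * F j \<omega>) / n"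
definition ee :: "nat \<Rightarrow> 'a \<Rightarrow> real" where "ee n \<omega> = (\<Sum>j<n. (E j \<omega>)\<^sup>2) / n"
definition ef :: "nat \<Rightarrow> 'a \<Rightarrow> real" where "ef n \<omega> = (\<Sum>j<n. E j \<omega> * F j \<omega>) / n"

lemma E_measurable [measurable]: "E j \<in> borel_measurable M"
  using indep_EF by (rule indep_var_rv1)

lemma F_measurable [measurable]: "F j \<in> borel_measurable M"
  using indep_EF by (rule indep_var_rv2)

lemma statistics_measurable [measurable]:
  "ze n \<in> borel_measurable M" "zf n \<in> borel_measurable M" "ee n \<in> borel_measurable M" "ef n \<in> borel_measurable M"
  unfolding ze_def[abs_def] zf_def[abs_def] ee_def[abs_def] ef_def[abs_def] by measurable

lemma n_mult_statistics:
  "n * zz n = (\<Sum>j<n. (Z n j)\<^sup>2)" "n * ze n \<omega> = (\<Sum>j<n. Z n j * E j \<omega>)" "n * zf n \<omega> = (\<Sum>j<n. Z n j * F j \<omega>)"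
  "n * ee n \<omega> = (\<Sum>j<n. (E j \<omega>)\<^sup>2)" "n * ef n \<omega> = (\<Sum>j<n. E j \<omega> * F j \<omega>)"
  by (simp_all add: zz_def ze_def zf_def ee_def ef_def)

lemma zz_tendsto: "zz \<longlonglongrightarrow> q"
  using Z_lim unfolding zz_def[abs_def] .

lemma integral_iexp_sum_E:
  "(CLINT \<omega>|M. iexp (\<Sum>j<n. \<alpha> j * E j \<omega>)) = of_real (exp (- (v * (\<Sum>j<n. (\<alpha> j)\<^sup>2)) / 2))"
proof -
  have "(CLINT \<omega>|M. iexp (\<Sum>j<n. \<alpha> j * E j \<omega>)) = (CLINT \<omega>|M. \<Prod>j<n. iexp (\<alpha> j * fst (E j \<omega>, F j \<omega>)))"
    by (simp only: iexp_sum fst_conv)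
  also have "\<dots> = (\<Prod>j<n. CLINT \<omega>|M. iexp (\<alpha> j * fst (E j \<omega>, F j \<omega>)))"
    by (rule indep_vars_integral_prod_bounded[OF _ indep_vars_subset[OF indep], where B=1])
       (auto intro!: borel_measurable_continuous_onI continuous_intros simp del: of_real_mult)
  also have "\<dots> = (\<Prod>j<n. char (distr M borel (E j)) (\<alpha> j))"
    by (simp add: char_def integral_distr)
  also have "\<dots> = of_real (exp (\<Sum>j<n. - (v * (\<alpha> j)\<^sup>2) / 2))"
    using v_pos by (simp add: distr_E char_normal_law exp_sum)
  also have "(\<Sum>j<n. - (v * (\<alpha> j)\<^sup>2) / 2) = - (v * (\<Sum>j<n. (\<alpha> j)\<^sup>2)) / 2"
    by (simp add: sum_distrib_left sum_negf sum_divide_distrib)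
  finally show ?thesis .
qed

lemma integral_iexp_bilinear:
  "(CLINT \<omega>|M. iexp (\<alpha> * E j \<omega> + (\<beta> + \<theta> * E j \<omega>) * F j \<omega>))
    = (CLINT \<omega>|M. iexp (\<alpha> * E j \<omega>) * of_real (exp (- (w * (\<beta> + \<theta> * E j \<omega>)\<^sup>2) / 2)))"
proof -
  have "(CLINT \<omega>|M. iexp (\<alpha> * E j \<omega> + (\<beta> + \<theta> * E j \<omega>) * F j \<omega>))
      = (CLINT \<omega>|M. iexp (\<alpha> * E j \<omega>) * char (distr M borel (F j)) (\<beta> + \<theta> * E j \<omega>))"
    by (rule integral_iexp_affine_indep[OF indep_EF]) measurable
  then show ?thesis
    by (simp only: distr_F char_normal_law[OF w_nonneg])
qed

lemma integral_iexp_sum_bilinear: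
  "(CLINT \<omega>|M. iexp (\<Sum>j<n. \<alpha> j * E j \<omega> + (\<beta> j + \<theta> j * E j \<omega>) * F j \<omega>))
    = (CLINT \<omega>|M. iexp (\<Sum>j<n. \<alpha> j * E j \<omega>)
        * of_real (exp (- (w * (\<Sum>j<n. (\<beta> j + \<theta> j * E j \<omega>)\<^sup>2)) / 2)))"
proof -
  define G where "G j z = iexp (\<alpha> j * fst z + (\<beta> j + \<theta> j * fst z) * snd z)" for j and z :: "real \<times> real"
  define H where "H j z = iexp (\<alpha> j * fst z) * of_real (exp (- (w * (\<beta> j + \<theta> j * fst z)\<^sup>2) / 2))"
    for j and z :: "real \<times> real"
  have G: "G j \<in> borel_measurable borel" "cmod (G j z) \<le> 1" for j z
    unfolding G_def
    by (auto intro!: borel_measurable_continuous_onI continuous_intros simp del: of_real_add of_real_mult)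
  have H: "H j \<in> borel_measurable borel" "cmod (H j z) \<le> 1" for j z
    unfolding H_def using w_nonneg
    by (auto intro!: borel_measurable_continuous_onI continuous_intros simp: norm_mult simp del: of_real_mult)
  have "(CLINT \<omega>|M. iexp (\<Sum>j<n. \<alpha> j * E j \<omega> + (\<beta> j + \<theta> j * E j \<omega>) * F j \<omega>))
      = (CLINT \<omega>|M. \<Prod>j<n. G j (E j \<omega>, F j \<omega>))"
    by (simp only: G_def iexp_sum fst_conv snd_conv)
  also have "\<dots> = (\<Prod>j<n. CLINT \<omega>|M. G j (E j \<omega>, F j \<omega>))"
    using G by (intro indep_vars_integral_prod_bounded[OF _ indep_vars_subset[OF indep], where B=1]) auto
  also have "\<dots> = (\<Prod>j<n. CLINT \<omega>|M. H j (E j \<omega>, F j \<omega>))"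
    by (simp only: G_def H_def fst_conv snd_conv integral_iexp_bilinear)
  also have "\<dots> = (CLINT \<omega>|M. \<Prod>j<n. H j (E j \<omega>, F j \<omega>))"
    using H by (intro indep_vars_integral_prod_bounded[OF _ indep_vars_subset[OF indep], where B=1, symmetric]) auto
  also have "\<dots> = (CLINT \<omega>|M. iexp (\<Sum>j<n. \<alpha> j * E j \<omega>)
      * of_real (exp (- (w * (\<Sum>j<n. (\<beta> j + \<theta> j * E j \<omega>)\<^sup>2)) / 2)))"
  proof (rule Bochner_Integration.integral_cong[OF refl])
    fix \<omega>
    have "- (w * (\<Sum>j<n. (\<beta> j + \<theta> j * E j \<omega>)\<^sup>2)) / 2 = (\<Sum>j<n. - (w * (\<beta> j + \<theta> j * E j \<omega>)\<^sup>2) / 2)"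
      by (simp add: sum_distrib_left sum_negf sum_divide_distrib)
    then show "(\<Prod>j<n. H j (E j \<omega>, F j \<omega>)) = iexp (\<Sum>j<n. \<alpha> j * E j \<omega>)
        * of_real (exp (- (w * (\<Sum>j<n. (\<beta> j + \<theta> j * E j \<omega>)\<^sup>2)) / 2))"
      by (simp only: H_def fst_conv prod.distrib iexp_sum exp_sum[OF finite_lessThan] of_real_prod)
  qed
  finally show ?thesis .
qed

definition cond_var :: "real \<Rightarrow> real \<Rightarrow> nat \<Rightarrow> 'a \<Rightarrow> real" where
  "cond_var b c n \<omega> = b\<^sup>2 * zz n + 2 * b * c * ze n \<omega> + c\<^sup>2 * ee n \<omega>"

lemma cond_var_measurable [measurable]: "cond_var b c n \<in> borel_measurable M"
  unfolding cond_var_def[abs_def] by measurable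

lemma cond_var_eq_sum:
  "cond_var b c n \<omega> = (\<Sum>j<n. (b * Z n j / sqrt n + c / sqrt n * E j \<omega>)\<^sup>2)"
proof -
  have "(b * Z n j / sqrt n + c / sqrt n * E j \<omega>)\<^sup>2
      = b\<^sup>2 * ((Z n j)\<^sup>2 / n) + 2 * b * c * (Z n j * E j \<omega> / n) + c\<^sup>2 * ((E j \<omega>)\<^sup>2 / n)" for j
    by (simp add: power2_sum power_divide power_mult_distrib add_divide_distrib)
  then show ?thesis
    by (simp add: cond_var_def zz_def ze_def ee_def sum.distrib sum_distrib_left sum_divide_distrib)
qed

lemma cond_var_nonneg: "0 \<le> cond_var b c n \<omega>"
  unfolding cond_var_eq_sum by (intro sum_nonneg) auto

lemma scaled_ze_eq_sum: "sqrt n * (a * ze n \<omega>) = (\<Sum>j<n. a * Z n j / sqrt n * E j \<omega>)"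
  unfolding ze_def sqrt_mult_divide_self[OF of_nat_0_le_iff]
  by (simp add: sum_distrib_left sum_divide_distrib mult.assoc)

lemma scaled_statistics_eq_sum:
  "sqrt n * (a * ze n \<omega> + b * zf n \<omega> + c * ef n \<omega>)
    = (\<Sum>j<n. a * Z n j / sqrt n * E j \<omega> + (b * Z n j / sqrt n + c / sqrt n * E j \<omega>) * F j \<omega>)"
  unfolding distrib_left ze_def zf_def ef_def sqrt_mult_divide_self[OF of_nat_0_le_iff]
  by (simp add: sum.distrib sum_distrib_left sum_divide_distrib algebra_simps)

lemma integral_iexp_ze:
  "(CLINT \<omega>|M. iexp (sqrt n * (a * ze n \<omega>))) = of_real (exp (- (v * zz n * a\<^sup>2) / 2))"
proof -
  have "(\<Sum>j<n. (a * Z n j / sqrt n)\<^sup>2) = zz n * a\<^sup>2"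
    by (simp add: zz_def power_divide power_mult_distrib sum_divide_distrib sum_distrib_left mult.commute)
  then show ?thesis
    unfolding scaled_ze_eq_sum integral_iexp_sum_E by (simp add: mult.assoc)
qed

lemma integral_iexp_statistics:
  "(CLINT \<omega>|M. iexp (sqrt n * (a * ze n \<omega> + b * zf n \<omega> + c * ef n \<omega>)))
    = (CLINT \<omega>|M. iexp (sqrt n * (a * ze n \<omega>)) * of_real (exp (- (w * cond_var b c n \<omega>) / 2)))"
  unfolding scaled_ze_eq_sum scaled_statistics_eq_sum cond_var_eq_sum by (rule integral_iexp_sum_bilinear)

lemma bdd_in_prob_ze: "bdd_in_prob (\<lambda>n \<omega>. sqrt n * ze n \<omega>)"
proof (rule bdd_in_prob_normal_limit)
  show "0 \<le> v * q"
    using v_pos q_pos by simp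
  show "(\<lambda>n. CLINT \<omega>|M. iexp (t * (sqrt n * ze n \<omega>))) \<longlonglongrightarrow> of_real (exp (- (v * q * t\<^sup>2) / 2))" for t
    unfolding mult.left_commute[of t] integral_iexp_ze by (intro tendsto_intros zz_tendsto) simp
qed measurable

lemma ze_tendsto: "tends_in_prob ze 0"
  by (rule sqrt_bdd_in_prob_imp_tends_in_prob_0[OF _ bdd_in_prob_ze]) measurable

lemma ee_tendsto: "tends_in_prob ee v"
proof -
  have even_moment: "has_bochner_integral M (\<lambda>\<omega>. (E j \<omega>) ^ (2 * k)) (fact (2 * k) / ((2 / v) ^ k * fact k))" for j k
    using has_bochner_integral_normal_law_even[OF v_pos, of k] unfolding distr_E[of j, symmetric]
    by (simp add: has_bochner_integral_iff integrable_distr_eq integral_distr)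
  have "fact (2 * 1) / ((2 / v) ^ 1 * fact 1) = v" "fact (2 * 2) / ((2 / v) ^ 2 * fact 2) = 3 * v\<^sup>2"
    using v_pos by (simp_all add: fact_numeral field_simps)
  then have moments: "integrable M (\<lambda>\<omega>. (E j \<omega>)\<^sup>2)" "expectation (\<lambda>\<omega>. (E j \<omega>)\<^sup>2) = v"
    "integrable M (\<lambda>\<omega>. (E j \<omega>) ^ 4)" "expectation (\<lambda>\<omega>. (E j \<omega>) ^ 4) = 3 * v\<^sup>2" for j
    using even_moment[of j 1] even_moment[of j 2] by (simp_all add: has_bochner_integral_iff)
  have square: "((E j \<omega>)\<^sup>2)\<^sup>2 = (E j \<omega>) ^ 4" for j \<omega>
    by simp
  have "indep_vars (\<lambda>_. borel) (\<lambda>j \<omega>. (fst (E j \<omega>, F j \<omega>))\<^sup>2) UNIV"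
    by (rule indep_vars_compose2[OF indep]) (intro borel_measurable_continuous_onI continuous_intros)
  moreover have "variance (\<lambda>\<omega>. (E j \<omega>)\<^sup>2) \<le> 2 * v\<^sup>2" for j
    using moments[of j] by (subst variance_eq) (simp_all add: square)
  ultimately have "tends_in_prob (\<lambda>n \<omega>. (\<Sum>j<n. (E j \<omega>)\<^sup>2) / n) v"
    using moments by (intro weak_law_of_large_numbers) (simp_all add: square)
  then show ?thesis
    by (simp add: ee_def[abs_def])
qed

lemma cond_var_tendsto: "tends_in_prob (cond_var b c) (b\<^sup>2 * q + c\<^sup>2 * v)"
proof -
  have "tends_in_prob (\<lambda>n \<omega>. b\<^sup>2 * zz n + 2 * b * c * ze n \<omega> + c\<^sup>2 * ee n \<omega>) (b\<^sup>2 * q + 2 * b * c * 0 + c\<^sup>2 * v)"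
    by (intro tends_in_prob_add tends_in_prob_mult ze_tendsto ee_tendsto
        tends_in_prob_const tendsto_const zz_tendsto; measurable)
  then show ?thesis
    by (simp add: cond_var_def[abs_def])
qed

lemma integral_iexp_statistics_tendsto:
  "(\<lambda>n. CLINT \<omega>|M. iexp (sqrt n * (a * ze n \<omega> + b * zf n \<omega> + c * ef n \<omega>)))
    \<longlonglongrightarrow> of_real (exp (- (v * q * a\<^sup>2 + w * q * b\<^sup>2 + v * w * c\<^sup>2) / 2))"
proof -
  let ?U = "\<lambda>n \<omega>. iexp (sqrt (real n) * (a * ze n \<omega>))"
  let ?W = "\<lambda>n \<omega>. complex_of_real (exp (- (w * cond_var b c n \<omega>) / 2))"
  let ?w = "complex_of_real (exp (- (w * (b\<^sup>2 * q + c\<^sup>2 * v)) / 2))"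
  have "tends_in_prob ?W ?w"
    by (rule tends_in_prob_isCont[OF cond_var_measurable cond_var_tendsto]) (intro continuous_intros, simp)
  then have diff: "(\<lambda>n. (CLINT \<omega>|M. ?U n \<omega> * ?W n \<omega>) - (CLINT \<omega>|M. ?U n \<omega>) * ?w) \<longlonglongrightarrow> 0"
    by (rule tends_in_prob_integral_mult[where B=1, rotated 3])
       (use w_nonneg cond_var_nonneg in \<open>auto simp del: of_real_mult\<close>)
  have "(\<lambda>n. (CLINT \<omega>|M. ?U n \<omega>) * ?w) \<longlonglongrightarrow> of_real (exp (- (v * q * a\<^sup>2) / 2)) * ?w"
    unfolding integral_iexp_ze by (intro tendsto_intros zz_tendsto) simp
  from Lim_transform[OF this diff]
  have "(\<lambda>n. CLINT \<omega>|M. ?U n \<omega> * ?W n \<omega>) \<longlonglongrightarrow> of_real (exp (- (v * q * a\<^sup>2) / 2)) * ?w" .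
  also have "of_real (exp (- (v * q * a\<^sup>2) / 2)) * ?w
      = complex_of_real (exp (- (v * q * a\<^sup>2 + w * q * b\<^sup>2 + v * w * c\<^sup>2) / 2))"
    unfolding of_real_mult[symmetric] exp_add[symmetric] by (simp add: field_simps)
  finally show ?thesis
    unfolding integral_iexp_statistics .
qed

lemma bdd_in_prob_zf: "bdd_in_prob (\<lambda>n \<omega>. sqrt n * zf n \<omega>)"
proof (rule bdd_in_prob_normal_limit)
  show "0 \<le> w * q"
    using w_nonneg q_pos by simp
  show "(\<lambda>n. CLINT \<omega>|M. iexp (t * (sqrt n * zf n \<omega>))) \<longlonglongrightarrow> of_real (exp (- (w * q * t\<^sup>2) / 2))" for t
    using integral_iexp_statistics_tendsto[of 0 t 0] by (simp add: mult.left_commute)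
qed measurable

lemma bdd_in_prob_ef: "bdd_in_prob (\<lambda>n \<omega>. sqrt n * ef n \<omega>)"
proof (rule bdd_in_prob_normal_limit)
  show "0 \<le> v * w"
    using w_nonneg v_pos by simp
  show "(\<lambda>n. CLINT \<omega>|M. iexp (t * (sqrt n * ef n \<omega>))) \<longlonglongrightarrow> of_real (exp (- (v * w * t\<^sup>2) / 2))" for t
    using integral_iexp_statistics_tendsto[of 0 0 t] by (simp add: mult.left_commute)
qed measurable

end

section \<open>The mediation model\<close>

lemma (in prob_space) conv_distr2_char_tendsto:
  assumes X: "\<And>n. X n \<in> borel_measurable M" and \<mu>: "borel_distribution \<mu>"
    and lim: "\<And>s t. (\<lambda>n. CLINT \<omega>|M. iexp (s * fst (X n \<omega>) + t * snd (X n \<omega>))) \<longlonglongrightarrow> char_vec \<mu> (s, t)"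
  shows "conv_distr2 M X \<mu>"
  unfolding conv_distr2_def
proof (intro allI impI)
  fix f :: "real \<times> real \<Rightarrow> real"
  assume f: "continuous_on UNIV f \<and> bounded (range f)"
  have "(\<lambda>n. \<integral>x. f x \<partial>distr M borel (X n)) \<longlonglongrightarrow> (\<integral>x. f x \<partial>\<mu>)"
  proof (rule levy_continuity_euclidean)
    show "(\<lambda>n. char_vec (distr M borel (X n)) u) \<longlonglongrightarrow> char_vec \<mu> u" for u
      using lim[of "fst u" "snd u"] by (simp add: char_vec_distr X inner_prod_def)
  qed (use X \<mu> f in \<open>auto intro: borel_distribution_distr\<close>)
  then show "(\<lambda>n. \<integral>\<omega>. f (X n \<omega>) \<partial>M) \<longlonglongrightarrow> (\<integral>x. f x \<partial>\<mu>)"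
    using f by (simp add: integral_distr[OF X] borel_measurable_continuous_onI)
qed

text \<open>Ordinary least squares for \<open>R = C Z + B M + \<gamma> E + F\<close>, \<open>M = A Z + E\<close>: since
  \<open>\<gamma> E = \<gamma> M - \<gamma> A Z\<close>, the bias of the estimator of \<open>C\<close> is \<open>-\<gamma> A\<close>, and adding
  \<open>\<gamma> Z\<^sup>T M / Z\<^sup>T Z\<close> removes it up to \<open>\<gamma> Z\<^sup>T E / Z\<^sup>T Z\<close>.\<close>

lemma ols_corrected_error:
  fixes S U W G T A B C \<gamma> :: real
  assumes "S \<noteq> 0" "S * T - U\<^sup>2 \<noteq> 0"
  defines "ZM \<equiv> A * S + U"
    and "ZR \<equiv> C * S + B * (A * S + U) + \<gamma> * U + W"
    and "MM \<equiv> A\<^sup>2 * S + 2 * A * U + T"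
    and "MR \<equiv> C * (A * S + U) + B * (A\<^sup>2 * S + 2 * A * U + T) + \<gamma> * (A * U + T) + (A * W + G)"
  shows "(MM * ZR - ZM * MR) / (S * MM - ZM\<^sup>2) + \<gamma> * ZM / S - C
    = \<gamma> / S * U + (A * U + T) / (S * T - U\<^sup>2) * W - (A * S + U) / (S * T - U\<^sup>2) * G"
proof -
  have den: "S * MM - ZM\<^sup>2 = S * T - U\<^sup>2"
    by (simp add: ZM_def MM_def power2_eq_square algebra_simps)
  have num: "MM * ZR - ZM * MR = (C - \<gamma> * A) * (S * T - U\<^sup>2) + ((A * U + T) * W - (A * S + U) * G)"
    by (simp add: ZM_def ZR_def MM_def MR_def power2_eq_square algebra_simps)
  have "\<gamma> * ZM / S = \<gamma> * A + \<gamma> / S * U"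
    using assms(1) by (simp add: ZM_def field_simps)
  moreover have "((C - \<gamma> * A) * D + (a * W - b * G)) / D = C - \<gamma> * A + a / D * W - b / D * G"
    if "D \<noteq> 0" for a b D
    using that by (simp add: field_simps)
  ultimately show ?thesis
    unfolding den num using assms(2) by simp
qed

locale mediation_model = prob_space P for P :: "'a measure" +
  fixes E1 E2 :: "nat \<Rightarrow> 'a \<Rightarrow> real" and Z :: "nat \<Rightarrow> nat \<Rightarrow> real" and A B C \<sigma>1 \<sigma>2 \<delta> q :: real
  assumes \<sigma>1_pos: "\<sigma>1 > 0" and \<delta>_bounds: "-1 < \<delta>" "\<delta> < 1"
    and indep_errors: "indep_vars (\<lambda>_. borel) (\<lambda>j \<omega>. (E1 j \<omega>, E2 j \<omega>)) UNIV"
    and errors_measurable: "\<And>j. (\<lambda>\<omega>. (E1 j \<omega>, E2 j \<omega>)) \<in> borel_measurable P"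
    and errors_gaussian: "\<And>j. gaussian2 (distr P borel (\<lambda>\<omega>. (E1 j \<omega>, E2 j \<omega>))) (\<sigma>1\<^sup>2) (\<delta> * \<sigma>1 * \<sigma>2) (\<sigma>2\<^sup>2)"
    and q_positive: "q > 0"
    and design_tendsto: "(\<lambda>n. (\<Sum>j<n. (Z n j)\<^sup>2) / real n) \<longlonglongrightarrow> q"
begin

definition \<gamma> :: real where "\<gamma> = \<delta> * \<sigma>2 / \<sigma>1"
definition w :: real where "w = \<sigma>2\<^sup>2 * (1 - \<delta>\<^sup>2)"
definition F :: "nat \<Rightarrow> 'a \<Rightarrow> real" where "F j \<omega> = E2 j \<omega> - \<gamma> * E1 j \<omega>"

lemma E2_eq: "E2 j \<omega> = \<gamma> * E1 j \<omega> + F j \<omega>"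
  by (simp add: F_def)

lemma residual_variance_nonneg: "0 \<le> w"
  using \<delta>_bounds abs_square_le_1[of \<delta>] by (simp add: w_def)

lemma error_quad_form:
  "quad_form2 (\<sigma>1\<^sup>2) (\<delta> * \<sigma>1 * \<sigma>2) (\<sigma>2\<^sup>2) s t = \<sigma>1\<^sup>2 * (s + \<gamma> * t)\<^sup>2 + w * t\<^sup>2"
  using \<sigma>1_pos by (simp add: quad_form2_def \<gamma>_def w_def power2_eq_square field_simps)

lemma integral_iexp_E1_F:
  "(CLINT \<omega>|P. iexp (s * E1 j \<omega> + t * F j \<omega>)) = of_real (exp (- (\<sigma>1\<^sup>2 * s\<^sup>2 + w * t\<^sup>2) / 2))"
proof -
  let ?D = "distr P borel (\<lambda>\<omega>. (E1 j \<omega>, E2 j \<omega>))"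
  have psd: "0 \<le> quad_form2 (\<sigma>1\<^sup>2) (\<delta> * \<sigma>1 * \<sigma>2) (\<sigma>2\<^sup>2) s t" for s t
    unfolding error_quad_form using residual_variance_nonneg by simp
  have "(CLINT \<omega>|P. iexp (s * E1 j \<omega> + t * F j \<omega>)) = char_vec ?D (s - \<gamma> * t, t)"
    by (simp add: char_vec_distr[OF errors_measurable] inner_Pair F_def algebra_simps)
  also have "\<dots> = of_real (exp (- quad_form2 (\<sigma>1\<^sup>2) (\<delta> * \<sigma>1 * \<sigma>2) (\<sigma>2\<^sup>2) (s - \<gamma> * t) t / 2))"
    using errors_gaussian[of j] unfolding gaussian2_iff_char_vec[OF psd] by blast
  finally show ?thesis
    by (simp add: error_quad_form)
qed

sublocale gaussian_error_array P E1 F Z "\<sigma>1\<^sup>2" w q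
proof
  have "(\<lambda>z :: real \<times> real. (fst z, snd z - \<gamma> * fst z)) \<in> borel_measurable borel"
    by (intro borel_measurable_continuous_onI continuous_intros)
  then show indep: "indep_vars (\<lambda>_. borel) (\<lambda>j \<omega>. (E1 j \<omega>, F j \<omega>)) UNIV"
    using indep_vars_compose2[OF indep_errors, of "\<lambda>_ z. (fst z, snd z - \<gamma> * fst z)" "\<lambda>_. borel"]
    by (simp add: F_def)
  fix j
  have pair: "(\<lambda>\<omega>. (E1 j \<omega>, F j \<omega>)) \<in> borel_measurable P"
    using indep by (simp add: indep_vars_def)
  have E1: "E1 j \<in> borel_measurable P"
    using measurable_compose[OF pair, of fst borel] by (simp add: borel_measurable_continuous_onI continuous_on_fst)
  have F: "F j \<in> borel_measurable P"
    using measurable_compose[OF pair, of snd borel] by (simp add: borel_measurable_continuous_onI continuous_on_snd)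
  show "distr P borel (E1 j) = normal_law (\<sigma>1\<^sup>2)"
    using E1 integral_iexp_E1_F[of _ j 0] by (intro distr_eq_normal_lawI) auto
  show "distr P borel (F j) = normal_law w"
    using F residual_variance_nonneg integral_iexp_E1_F[of 0 j] by (intro distr_eq_normal_lawI) auto
  show "indep_var borel (E1 j) borel (F j)"
    using E1 F integral_iexp_E1_F[of _ j 0] integral_iexp_E1_F[of 0 j] integral_iexp_E1_F[of _ j]
    by (intro indep_var_char_vecI)
       (simp_all add: add_divide_distrib diff_divide_distrib flip: exp_add of_real_mult)
qed (use \<sigma>1_pos residual_variance_nonneg q_positive design_tendsto in auto)

definition Mv :: "nat \<Rightarrow> nat \<Rightarrow> 'a \<Rightarrow> real" where "Mv n j \<omega> = Z n j * A + E1 j \<omega>"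
definition Rv :: "nat \<Rightarrow> nat \<Rightarrow> 'a \<Rightarrow> real" where "Rv n j \<omega> = Z n j * C + Mv n j \<omega> * B + E2 j \<omega>"
definition ZZ :: "nat \<Rightarrow> real" where "ZZ n = (\<Sum>j<n. Z n j * Z n j)"
definition ZM :: "nat \<Rightarrow> 'a \<Rightarrow> real" where "ZM n \<omega> = (\<Sum>j<n. Z n j * Mv n j \<omega>)"
definition ZR :: "nat \<Rightarrow> 'a \<Rightarrow> real" where "ZR n \<omega> = (\<Sum>j<n. Z n j * Rv n j \<omega>)"
definition MM :: "nat \<Rightarrow> 'a \<Rightarrow> real" where "MM n \<omega> = (\<Sum>j<n. Mv n j \<omega> * Mv n j \<omega>)"
definition MR :: "nat \<Rightarrow> 'a \<Rightarrow> real" where "MR n \<omega> = (\<Sum>j<n. Mv n j \<omega> * Rv n j \<omega>)"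

definition total_effect_hat :: "nat \<Rightarrow> 'a \<Rightarrow> real" where
  "total_effect_hat n \<omega> = ZR n \<omega> / ZZ n"

definition direct_effect_hat :: "nat \<Rightarrow> 'a \<Rightarrow> real" where
  "direct_effect_hat n \<omega> = (MM n \<omega> * ZR n \<omega> - ZM n \<omega> * MR n \<omega>) / (ZZ n * MM n \<omega> - (ZM n \<omega>)\<^sup>2)
     + \<delta> * \<sigma>2 * ZM n \<omega> / (\<sigma>1 * ZZ n)"

definition total_error :: "nat \<Rightarrow> 'a \<Rightarrow> real" where
  "total_error n \<omega> = sqrt n * (total_effect_hat n \<omega> - (C + A * B))"

definition direct_error :: "nat \<Rightarrow> 'a \<Rightarrow> real" where
  "direct_error n \<omega> = sqrt n * (direct_effect_hat n \<omega> - C)"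

lemma product_sums_eq:
  "ZZ n = n * zz n"
  "ZM n \<omega> = n * (A * zz n + ze n \<omega>)"
  "ZR n \<omega> = n * (C * zz n + B * (A * zz n + ze n \<omega>) + \<gamma> * ze n \<omega> + zf n \<omega>)"
  "MM n \<omega> = n * (A\<^sup>2 * zz n + 2 * A * ze n \<omega> + ee n \<omega>)"
  "MR n \<omega> = n * (C * (A * zz n + ze n \<omega>) + B * (A\<^sup>2 * zz n + 2 * A * ze n \<omega> + ee n \<omega>)
    + \<gamma> * (A * ze n \<omega> + ee n \<omega>) + (A * zf n \<omega> + ef n \<omega>))"
  unfolding distrib_left mult.left_commute[of "real n"] n_mult_statistics
  by (simp_all add: ZZ_def ZM_def ZR_def MM_def MR_def Rv_def Mv_def E2_eq
      sum.distrib sum_distrib_left power2_eq_square algebra_simps)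

lemma errors_borel_measurable [measurable]:
  "total_error n \<in> borel_measurable P" "direct_error n \<in> borel_measurable P"
  unfolding total_error_def[abs_def] direct_error_def[abs_def] total_effect_hat_def direct_effect_hat_def
    product_sums_eq by measurable

definition gram :: "nat \<Rightarrow> 'a \<Rightarrow> real" where
  "gram n \<omega> = zz n * ee n \<omega> - (ze n \<omega>)\<^sup>2"

lemma gram_measurable [measurable]: "gram n \<in> borel_measurable P"
  unfolding gram_def[abs_def] by measurable

lemma gram_tendsto: "tends_in_prob gram (q * \<sigma>1\<^sup>2)"
proof -
  have "tends_in_prob (\<lambda>n \<omega>. zz n * ee n \<omega> - ze n \<omega> * ze n \<omega>) (q * \<sigma>1\<^sup>2 - 0 * 0)"
    by (intro tends_in_prob_diff tends_in_prob_mult ze_tendsto ee_tendsto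
        tends_in_prob_const zz_tendsto; measurable)
  then show ?thesis
    by (simp add: gram_def[abs_def] power2_eq_square)
qed

lemma total_error_eq:
  assumes "n > 0" "zz n \<noteq> 0"
  shows "total_error n \<omega> = (B + \<gamma>) / zz n * (sqrt n * ze n \<omega>) + 1 / zz n * (sqrt n * zf n \<omega>)"
  using assms by (simp add: total_error_def total_effect_hat_def product_sums_eq field_simps)

lemma direct_error_eq:
  assumes "n > 0" "zz n \<noteq> 0" "gram n \<omega> \<noteq> 0"
  shows "direct_error n \<omega> = \<gamma> / zz n * (sqrt n * ze n \<omega>)
    + (A * ze n \<omega> + ee n \<omega>) / gram n \<omega> * (sqrt n * zf n \<omega>)
    - (A * zz n + ze n \<omega>) / gram n \<omega> * (sqrt n * ef n \<omega>)"
proof -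
  have cancel: "(n * a * (n * b) - n * c * (n * d)) / (n * e * (n * a) - (n * c)\<^sup>2) = (a * b - c * d) / (e * a - c\<^sup>2)"
    for a b c d e :: real
  proof -
    have "(n * a * (n * b) - n * c * (n * d)) / (n * e * (n * a) - (n * c)\<^sup>2)
        = ((real n)\<^sup>2 * (a * b - c * d)) / ((real n)\<^sup>2 * (e * a - c\<^sup>2))"
      by (simp add: power2_eq_square algebra_simps)
    then show ?thesis
      using assms(1) by simp
  qed
  have bias: "\<delta> * \<sigma>2 * (n * c) / (\<sigma>1 * (n * e)) = \<gamma> * c / e" for c e :: real
    using assms(1) by (simp add: \<gamma>_def)
  have error: "direct_effect_hat n \<omega> - C = \<gamma> / zz n * ze n \<omega> + (A * ze n \<omega> + ee n \<omega>) / gram n \<omega> * zf n \<omega>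
      - (A * zz n + ze n \<omega>) / gram n \<omega> * ef n \<omega>"
    unfolding direct_effect_hat_def product_sums_eq cancel bias gram_def
    using assms(2,3) by (intro ols_corrected_error) (simp_all add: gram_def)
  show ?thesis
    unfolding direct_error_def error by (simp only: distrib_left right_diff_distrib mult.left_commute)
qed

lemma eventually_zz_pos: "\<forall>\<^sub>F n in sequentially. 0 < zz n"
  using zz_tendsto q_pos by (rule order_tendstoD)

definition total_error_linear :: "nat \<Rightarrow> 'a \<Rightarrow> real" where
  "total_error_linear n \<omega> = (B + \<gamma>) / q * (sqrt n * ze n \<omega>) + 1 / q * (sqrt n * zf n \<omega>)"

definition direct_error_linear :: "nat \<Rightarrow> 'a \<Rightarrow> real" where
  "direct_error_linear n \<omega> = \<gamma> / q * (sqrt n * ze n \<omega>) + 1 / q * (sqrt n * zf n \<omega>) - A / \<sigma>1\<^sup>2 * (sqrt n * ef n \<omega>)"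

lemma linear_errors_measurable [measurable]:
  "total_error_linear n \<in> borel_measurable P" "direct_error_linear n \<in> borel_measurable P"
  unfolding total_error_linear_def[abs_def] direct_error_linear_def[abs_def] by measurable

lemma total_error_linearization:
  "tends_in_prob (\<lambda>n \<omega>. total_error n \<omega> - total_error_linear n \<omega>) 0"
proof -
  let ?D = "\<lambda>n \<omega>. ((B + \<gamma>) / zz n * (sqrt n * ze n \<omega>) - (B + \<gamma>) / q * (sqrt n * ze n \<omega>))
      + (1 / zz n * (sqrt n * zf n \<omega>) - 1 / q * (sqrt n * zf n \<omega>))"
  have "tends_in_prob ?D (0 + 0)"
    using q_pos
    by (intro tends_in_prob_add tends_in_prob_mult_bdd bdd_in_prob_ze bdd_in_prob_zf
        tends_in_prob_const tendsto_intros zz_tendsto; (measurable | simp))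
  then show ?thesis
    unfolding add_0
  proof (rule tends_in_prob_transform[where S="\<lambda>_. {}", rotated 2])
    show "\<forall>\<^sub>F n in sequentially. \<forall>\<omega>\<in>space P - {}. total_error n \<omega> - total_error_linear n \<omega> = ?D n \<omega>"
      using eventually_gt_at_top[of 0] eventually_zz_pos
      by eventually_elim (simp add: total_error_eq total_error_linear_def)
  qed auto
qed

lemma direct_error_coefficients_tendsto:
  "tends_in_prob (\<lambda>n \<omega>. \<gamma> / zz n) (\<gamma> / q)"
  "tends_in_prob (\<lambda>n \<omega>. (A * ze n \<omega> + ee n \<omega>) / gram n \<omega>) (1 / q)"
  "tends_in_prob (\<lambda>n \<omega>. (A * zz n + ze n \<omega>) / gram n \<omega>) (A / \<sigma>1\<^sup>2)"
proof -
  show "tends_in_prob (\<lambda>n \<omega>. \<gamma> / zz n) (\<gamma> / q)"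
    using q_pos by (intro tends_in_prob_const tendsto_intros zz_tendsto) simp
  have "tends_in_prob (\<lambda>n \<omega>. (A * ze n \<omega> + ee n \<omega>) / gram n \<omega>) ((A * 0 + \<sigma>1\<^sup>2) / (q * \<sigma>1\<^sup>2))"
    using q_pos v_pos
    by (intro tends_in_prob_divide tends_in_prob_add tends_in_prob_mult gram_tendsto ze_tendsto ee_tendsto
        tends_in_prob_const tendsto_const; (measurable | simp))
  then show "tends_in_prob (\<lambda>n \<omega>. (A * ze n \<omega> + ee n \<omega>) / gram n \<omega>) (1 / q)"
    using v_pos by simp
  have "tends_in_prob (\<lambda>n \<omega>. (A * zz n + ze n \<omega>) / gram n \<omega>) ((A * q + 0) / (q * \<sigma>1\<^sup>2))"
    using q_pos v_pos
    by (intro tends_in_prob_divide tends_in_prob_add gram_tendsto ze_tendsto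
        tends_in_prob_const tendsto_intros zz_tendsto; (measurable | simp))
  then show "tends_in_prob (\<lambda>n \<omega>. (A * zz n + ze n \<omega>) / gram n \<omega>) (A / \<sigma>1\<^sup>2)"
    using q_pos by simp
qed

lemma direct_error_linearization:
  "tends_in_prob (\<lambda>n \<omega>. direct_error n \<omega> - direct_error_linear n \<omega>) 0"
proof -
  let ?D = "\<lambda>n \<omega>. (\<gamma> / zz n * (sqrt n * ze n \<omega>) - \<gamma> / q * (sqrt n * ze n \<omega>))
      + ((A * ze n \<omega> + ee n \<omega>) / gram n \<omega> * (sqrt n * zf n \<omega>) - 1 / q * (sqrt n * zf n \<omega>))
      - ((A * zz n + ze n \<omega>) / gram n \<omega> * (sqrt n * ef n \<omega>) - A / \<sigma>1\<^sup>2 * (sqrt n * ef n \<omega>))"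
  have "tends_in_prob ?D (0 + 0 - 0)"
    by (intro tends_in_prob_diff tends_in_prob_add
        tends_in_prob_mult_bdd[OF _ _ direct_error_coefficients_tendsto(1) bdd_in_prob_ze]
        tends_in_prob_mult_bdd[OF _ _ direct_error_coefficients_tendsto(2) bdd_in_prob_zf]
        tends_in_prob_mult_bdd[OF _ _ direct_error_coefficients_tendsto(3) bdd_in_prob_ef]; measurable)
  then show ?thesis
    unfolding add_0 diff_0_right
  proof (rule tends_in_prob_transform[where S="\<lambda>n. {\<omega> \<in> space P. gram n \<omega> = 0}", rotated 2])
    show "(\<lambda>n. prob {\<omega> \<in> space P. gram n \<omega> = 0}) \<longlonglongrightarrow> 0"
      using q_pos v_pos by (intro tends_in_prob_imp_prob_eq_tendsto_0[OF _ gram_tendsto]) auto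
    show "\<forall>\<^sub>F n in sequentially. \<forall>\<omega>\<in>space P - {\<omega> \<in> space P. gram n \<omega> = 0}.
        direct_error n \<omega> - direct_error_linear n \<omega> = ?D n \<omega>"
      using eventually_gt_at_top[of 0] eventually_zz_pos
      by eventually_elim (auto simp: direct_error_eq direct_error_linear_def)
  qed measurable
qed

definition V11 :: real where "V11 = (B\<^sup>2 * \<sigma>1\<^sup>2 + 2 * B * \<delta> * \<sigma>1 * \<sigma>2 + \<sigma>2\<^sup>2) / q"
definition V12 :: real where "V12 = (\<sigma>2\<^sup>2 + B * \<delta> * \<sigma>1 * \<sigma>2) / q"
definition V22 :: real where "V22 = \<sigma>2\<^sup>2 * (q * A\<^sup>2 + \<sigma>1\<^sup>2 - q * A\<^sup>2 * \<delta>\<^sup>2) / (q * \<sigma>1\<^sup>2)"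

lemma quad_form2_V:
  "quad_form2 V11 V12 V22 s t
    = \<sigma>1\<^sup>2 * q * ((s * (B + \<gamma>) + t * \<gamma>) / q)\<^sup>2 + w * q * ((s + t) / q)\<^sup>2 + \<sigma>1\<^sup>2 * w * (- (t * A / \<sigma>1\<^sup>2))\<^sup>2"
  using \<sigma>1_pos q_pos
  by (simp add: quad_form2_def V11_def V12_def V22_def \<gamma>_def w_def power2_eq_square field_simps)

lemma quad_form2_V_nonneg: "0 \<le> quad_form2 V11 V12 V22 s t"
  unfolding quad_form2_V using q_pos residual_variance_nonneg by simp

lemma linear_errors_combination:
  "s * total_error_linear n \<omega> + t * direct_error_linear n \<omega>
    = sqrt n * ((s * (B + \<gamma>) + t * \<gamma>) / q * ze n \<omega> + (s + t) / q * zf n \<omega> + - (t * A / \<sigma>1\<^sup>2) * ef n \<omega>)"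
  by (simp add: total_error_linear_def direct_error_linear_def add_divide_distrib algebra_simps)

lemma integral_iexp_errors_tendsto:
  "(\<lambda>n. CLINT \<omega>|P. iexp (s * total_error n \<omega> + t * direct_error n \<omega>))
    \<longlonglongrightarrow> of_real (exp (- quad_form2 V11 V12 V22 s t / 2))"
proof -
  let ?X = "\<lambda>n \<omega>. s * total_error n \<omega> + t * direct_error n \<omega>"
  let ?L = "\<lambda>n \<omega>. s * total_error_linear n \<omega> + t * direct_error_linear n \<omega>"
  have "tends_in_prob (\<lambda>n \<omega>. s * (total_error n \<omega> - total_error_linear n \<omega>)
      + t * (direct_error n \<omega> - direct_error_linear n \<omega>)) (s * 0 + t * 0)"
    by (intro tends_in_prob_add tends_in_prob_mult tends_in_prob_const tendsto_const
        total_error_linearization direct_error_linearization; measurable)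
  then have "tends_in_prob (\<lambda>n \<omega>. ?X n \<omega> - ?L n \<omega>) 0"
    by (simp add: algebra_simps)
  then have diff: "(\<lambda>n. (CLINT \<omega>|P. iexp (?X n \<omega>)) - (CLINT \<omega>|P. iexp (?L n \<omega>))) \<longlonglongrightarrow> 0"
    by (intro integral_iexp_diff_tendsto_0) measurable
  have "(\<lambda>n. CLINT \<omega>|P. iexp (?L n \<omega>)) \<longlonglongrightarrow> of_real (exp (- quad_form2 V11 V12 V22 s t / 2))"
    unfolding linear_errors_combination quad_form2_V by (rule integral_iexp_statistics_tendsto)
  from Lim_transform[OF this diff] show ?thesis .
qed

theorem asymptotic_normality:
  "\<exists>\<mu>. gaussian2 \<mu> V11 V12 V22 \<and> conv_distr2 P (\<lambda>n \<omega>. (total_error n \<omega>, direct_error n \<omega>)) \<mu>"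
proof -
  obtain \<mu> where \<mu>: "gaussian2 \<mu> V11 V12 V22"
    using gaussian2_exists[OF quad_form2_V_nonneg] by blast
  then have "borel_distribution \<mu>"
    and char_\<mu>: "char_vec \<mu> (s, t) = of_real (exp (- quad_form2 V11 V12 V22 s t / 2))" for s t
    unfolding gaussian2_iff_char_vec[OF quad_form2_V_nonneg] by blast+
  then have "conv_distr2 P (\<lambda>n \<omega>. (total_error n \<omega>, direct_error n \<omega>)) \<mu>"
    using integral_iexp_errors_tendsto by (intro conv_distr2_char_tendsto) (simp_all add: char_\<mu>)
  with \<mu> show ?thesis
    by blast
qed

end

theorem theorem3:
  fixes P :: "'a measure"
    and E1 E2 :: "nat \<Rightarrow> 'a \<Rightarrow> real"
    and Z :: "nat \<Rightarrow> nat \<Rightarrow> real"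
    and A B C \<sigma>1 \<sigma>2 \<delta> q :: real
  assumes "prob_space P"
    and "\<sigma>1 > 0" and "\<sigma>2 > 0" and "-1 < \<delta>" and "\<delta> < 1"
    and "prob_space.indep_vars P (\<lambda>_. borel) (\<lambda>j \<omega>. (E1 j \<omega>, E2 j \<omega>)) UNIV"
    and "\<And>j. (\<lambda>\<omega>. (E1 j \<omega>, E2 j \<omega>)) \<in> borel_measurable P"
    and "\<And>j. gaussian2 (distr P borel (\<lambda>\<omega>. (E1 j \<omega>, E2 j \<omega>)))
                 (\<sigma>1\<^sup>2) (\<delta> * \<sigma>1 * \<sigma>2) (\<sigma>2\<^sup>2)"
    and "q > 0"
    and "(\<lambda>n. (\<Sum>j<n. (Z n j)\<^sup>2) / real n) \<longlonglongrightarrow> q"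
  shows
    "let Mv = (\<lambda>n j \<omega>. Z n j * A + E1 j \<omega>);
         Rv = (\<lambda>n j \<omega>. Z n j * C + Mv n j \<omega> * B + E2 j \<omega>);
         ZZ = (\<lambda>n. \<Sum>j<n. Z n j * Z n j);
         ZM = (\<lambda>n \<omega>. \<Sum>j<n. Z n j * Mv n j \<omega>);
         ZR = (\<lambda>n \<omega>. \<Sum>j<n. Z n j * Rv n j \<omega>);
         MM = (\<lambda>n \<omega>. \<Sum>j<n. Mv n j \<omega> * Mv n j \<omega>);
         MR = (\<lambda>n \<omega>. \<Sum>j<n. Mv n j \<omega> * Rv n j \<omega>);
         Chat' = (\<lambda>n \<omega>. ZR n \<omega> / ZZ n);
         Chat = (\<lambda>n \<omega>. (MM n \<omega> * ZR n \<omega> - ZM n \<omega> * MR n \<omega>)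
                          / (ZZ n * MM n \<omega> - (ZM n \<omega>)\<^sup>2)
                        + \<delta> * \<sigma>2 * ZM n \<omega> / (\<sigma>1 * ZZ n));
         X = (\<lambda>n \<omega>. (sqrt (real n) * (Chat' n \<omega> - (C + A * B)),
                      sqrt (real n) * (Chat n \<omega> - C)))
     in \<exists>\<mu>. gaussian2 \<mu>
              ((B\<^sup>2 * \<sigma>1\<^sup>2 + 2 * B * \<delta> * \<sigma>1 * \<sigma>2 + \<sigma>2\<^sup>2) / q)
              ((\<sigma>2\<^sup>2 + B * \<delta> * \<sigma>1 * \<sigma>2) / q)
              (\<sigma>2\<^sup>2 * (q * A\<^sup>2 + \<sigma>1\<^sup>2 - q * A\<^sup>2 * \<delta>\<^sup>2) / (q * \<sigma>1\<^sup>2))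
            \<and> conv_distr2 P X \<mu>"
proof -
  interpret mediation_model P E1 E2 Z A B C \<sigma>1 \<sigma>2 \<delta> q
    using assms by (intro mediation_model.intro mediation_model_axioms.intro)
  show ?thesis
    using asymptotic_normality
    unfolding Let_def V11_def V12_def V22_def total_error_def direct_error_def total_effect_hat_def direct_effect_hat_def
      ZZ_def ZM_def ZR_def MM_def MR_def Rv_def Mv_def .
qed

end
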